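(* Let $k \geq 2$ be an integer. There exists $n_0 = n_0(k)$ such that for every $n \geq n_0$, the unique graph (up to isomorphism) on $n$ vertices that contains neither $C_{2k+1}$ nor $C_{2k+2}$ as a subgraph and has the maximum adjacency spectral radius among all such graphs is $S_{n,k}$. That is, $\mathrm{SPEX}(n, \{C_{2k+1}, C_{2k+2}\}) = \{S_{n,k}\}$.
   Context: For a graph $G$, $\lambda(G)$ denotes the spectral radius of its adjacency matrix. For a family $\mathcal{F}$ of graphs, $\mathrm{SPEX}(n,\mathcal{F})$ is the set of $n$-vertex graphs containing no member of $\mathcal{F}$ as a subgraph whose spectral radius is maximum among all such $n$-vertex graphs. For $n>k$, $S_{n,k} := K_k \vee \overline{K}_{n-k}$ is the join of a clique on $k$ vertices with an independent set on $n-k$ vertices. *)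

theory Defs
  imports "Jordan_Normal_Form.Spectral_Radius"
begin

definition graph_on :: "nat \<Rightarrow> (nat \<Rightarrow> nat \<Rightarrow> bool) \<Rightarrow> bool" where
  "graph_on n G \<longleftrightarrow> (\<forall>i j. G i j \<longrightarrow> i < n \<and> j < n \<and> i \<noteq> j \<and> G j i)"

definition contains_subgraph ::
  "nat \<Rightarrow> (nat \<Rightarrow> nat \<Rightarrow> bool) \<Rightarrow> nat \<Rightarrow> (nat \<Rightarrow> nat \<Rightarrow> bool) \<Rightarrow> bool" where
  "contains_subgraph n G m H \<longleftrightarrow>
     (\<exists>f. inj_on f {..<m} \<and> f ` {..<m} \<subseteq> {..<n} \<and>
          (\<forall>i<m. \<forall>j<m. H i j \<longrightarrow> G (f i) (f j)))"

definition F_free ::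
  "(nat \<times> (nat \<Rightarrow> nat \<Rightarrow> bool)) set \<Rightarrow> nat \<Rightarrow> (nat \<Rightarrow> nat \<Rightarrow> bool) \<Rightarrow> bool" where
  "F_free F n G \<longleftrightarrow> (\<forall>(m, H) \<in> F. \<not> contains_subgraph n G m H)"

definition cycle_graph :: "nat \<Rightarrow> nat \<Rightarrow> nat \<Rightarrow> bool" where
  "cycle_graph m i j \<longleftrightarrow> i < m \<and> j < m \<and> (j = (i + 1) mod m \<or> i = (j + 1) mod m)"

definition adj_matrix :: "nat \<Rightarrow> (nat \<Rightarrow> nat \<Rightarrow> bool) \<Rightarrow> complex mat" where
  "adj_matrix n G = mat n n (\<lambda>(i, j). if G i j then 1 else 0)"

definition graph_spectral_radius :: "nat \<Rightarrow> (nat \<Rightarrow> nat \<Rightarrow> bool) \<Rightarrow> real" where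
  "graph_spectral_radius n G = spectral_radius (adj_matrix n G)"

definition SPEX ::
  "nat \<Rightarrow> (nat \<times> (nat \<Rightarrow> nat \<Rightarrow> bool)) set \<Rightarrow> (nat \<Rightarrow> nat \<Rightarrow> bool) set" where
  "SPEX n F = {G. graph_on n G \<and> F_free F n G \<and>
     (\<forall>G'. graph_on n G' \<and> F_free F n G' \<longrightarrow>
            graph_spectral_radius n G' \<le> graph_spectral_radius n G)}"

definition graph_iso :: "nat \<Rightarrow> (nat \<Rightarrow> nat \<Rightarrow> bool) \<Rightarrow> (nat \<Rightarrow> nat \<Rightarrow> bool) \<Rightarrow> bool" where
  "graph_iso n G H \<longleftrightarrow>
     (\<exists>f. bij_betw f {..<n} {..<n} \<and> (\<forall>i<n. \<forall>j<n. G i j \<longleftrightarrow> H (f i) (f j)))"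

text \<open>S_{n,k} = K_k join complement of K_{n-k}: vertices 0..<k form a clique, all other
  vertices are adjacent exactly to the clique vertices.\<close>
definition S_graph :: "nat \<Rightarrow> nat \<Rightarrow> nat \<Rightarrow> nat \<Rightarrow> bool" where
  "S_graph n k i j \<longleftrightarrow> i < n \<and> j < n \<and> i \<noteq> j \<and> (i < k \<or> j < k)"

end

(*
  Let G be extremal on n vertices, with spectral radius l, Perron vector x scaled to maximum
  entry 1 at w, and write codeg v b for the number of common neighbours of v and b, so that
  l^2 x_v = sum_b codeg v b * x_b.  A path on 2k+1 vertices alternating between N(v) and a
  disjoint set B, starting and ending in N(v), closes through v to a C_{2k+2}; hence by a
  minimum-degree argument at most (k-1) deg v + k |B| edges join N(v) to B, and a cruder linear
  bound covers the case that B meets N(v).  Comparison with S_{n,k} gives l^2 >= k n, so these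
  estimates are nearly tight.

  If deg w were o(n), then almost all entries of x would be close to 1 and almost all pairs of
  vertices would have at least two common neighbours, with no vertex of linear degree; a greedy
  choice then produces a C_{2k+2}.  So deg w is linear in n.  Looking at the largest entry among
  the vertices of small degree not adjacent to w shows next that only o(n) entries exceed any
  fixed constant, whence k n x_v <= deg v * (x_v + k - 1) + o(n).  Tightness at w yields exactly
  k vertices K with entries near 1, each of degree (1 - o(1)) n.  Forbidding C_{2k+1} and C_{2k+2}
  leaves almost no edges outside K, and replacing those edges by all edges from K to the
  rest increases the spectral radius unless G is already the join of K with an independent set.
*)
theory Submission
  imports Defs "HOL-Analysis.Function_Topology"
begin

section \<open>Counting edges between a neighbourhood and a set\<close>

text \<open>Where N(v) and B overlap, the counting bound is lossy, and the loss can be charged to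
  either side. Charged to deg v it keeps the sharp coefficient k on |B|, the form for vertices of
  small degree. Charged to |B| it keeps the sharp coefficient k-1 on deg v, the form for the small
  set of large entries. The obstacle at the end is the set Q of vertices outside K that miss some
  vertex of K. Its size is only bounded by a small multiple of n, and its inner edges are not
  controlled vertex by vertex. Their weight E under x is compared with the total weight X of Q in
  two moves: the spectral radius of the graph induced on Q is at most of order sqrt(k |Q|), and the
  eigenvalue equation summed over Q bounds l times the squared weight of Q by (k+1) X + E. Asking k
  times that radius to be at most l/8 is what makes \<eta> of order 1/k^3. Connectivity is not
  assumed, so x may vanish on Q; a strict increase of the spectral radius then needs a perturbed
  test vector.\<close>

definition nbrs :: "(nat \<Rightarrow> nat \<Rightarrow> bool) \<Rightarrow> nat \<Rightarrow> nat set" where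
  "nbrs G u = {v. G u v}"

definition codeg :: "(nat \<Rightarrow> nat \<Rightarrow> bool) \<Rightarrow> nat \<Rightarrow> nat \<Rightarrow> nat" where
  "codeg G u v = card (nbrs G u \<inter> nbrs G v)"

text \<open>A cycle is a list closed up by one edge, because the constructions below grow paths
  vertex by vertex; \<open>has_cycle_contains\<close> turns it into an embedded
  \<open>cycle_graph\<close>.\<close>

definition has_cycle :: "(nat \<Rightarrow> nat \<Rightarrow> bool) \<Rightarrow> nat \<Rightarrow> bool" where
  "has_cycle G m \<longleftrightarrow> (\<exists>p. length p = m \<and> distinct p \<and> successively G p \<and> G (last p) (hd p))"

lemma has_cycleI:
  assumes "length p = m" "distinct p" "successively G p" "G (last p) (hd p)"
  shows "has_cycle G m"
  using assms unfolding has_cycle_def by blast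

lemma has_cycle_mono:
  assumes "has_cycle H m" "\<And>u v. H u v \<Longrightarrow> G u v"
  shows "has_cycle G m"
proof -
  obtain p where "length p = m" "distinct p" "successively H p" "H (last p) (hd p)"
    using assms(1) unfolding has_cycle_def by blast
  moreover have "successively G p"
    using successively_mono[OF \<open>successively H p\<close>] assms(2) by blast
  ultimately show ?thesis using assms(2) by (intro has_cycleI)
qed

lemma graph_onD:
  assumes "graph_on n G" "G u v"
  shows "u < n" "v < n" "u \<noteq> v" "G v u"
  using assms by (simp_all add: graph_on_def)

lemma nbrs_subset: "graph_on n G \<Longrightarrow> nbrs G u \<subseteq> {..<n}"
  using graph_onD(2)[of n G u] by (auto simp: nbrs_def)

lemma finite_nbrs: "graph_on n G \<Longrightarrow> finite (nbrs G u)"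
  by (rule finite_subset[OF nbrs_subset finite_lessThan])

lemma card_nbrs_le: "graph_on n G \<Longrightarrow> card (nbrs G u) \<le> n"
  using card_mono[OF finite_lessThan nbrs_subset] by simp

lemma codeg_self: "codeg G u u = card (nbrs G u)"
  by (simp add: codeg_def)

text \<open>Delete vertices of A with at most p neighbours and vertices of B with at most q. Each
  deletion lowers the left side by no more than the right, so the strict inequality survives, and it
  rules out that A becomes empty.\<close>

lemma dense_pair_core:
  fixes R :: "'a \<Rightarrow> 'b \<Rightarrow> bool"
  assumes "finite A" "finite B"
    and "(\<Sum>b\<in>B. card {a\<in>A. R a b}) > p * card A + q * card B"
  shows "\<exists>A' B'. A' \<subseteq> A \<and> B' \<subseteq> B \<and> A' \<noteq> {} \<and> (\<forall>a\<in>A'. card {b\<in>B'. R a b} > p)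
      \<and> (\<forall>b\<in>B'. card {a\<in>A'. R a b} > q)"
  using assms
proof (induction "card A + card B" arbitrary: A B rule: less_induct)
  case less
  note fin = less.prems(1,2)
  have "(\<exists>a\<in>A. card {b\<in>B. R a b} \<le> p) \<or> (\<exists>b\<in>B. card {a\<in>A. R a b} \<le> q)
    \<or> (\<forall>a\<in>A. card {b\<in>B. R a b} > p) \<and> (\<forall>b\<in>B. card {a\<in>A. R a b} > q)"
    unfolding not_le[symmetric] by blast
  then consider (a) a where "a \<in> A" "card {b\<in>B. R a b} \<le> p"
    | (b) b where "b \<in> B" "card {a\<in>A. R a b} \<le> q"
    | (none) "\<forall>a\<in>A. card {b\<in>B. R a b} > p" "\<forall>b\<in>B. card {a\<in>A. R a b} > q"
    by (elim disjE bexE conjE)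
  then show ?case
  proof cases
    case a
    define A1 where "A1 = A - {a}"
    have fA1: "finite A1" using fin A1_def by simp
    have split: "card {a\<in>A. R a b} = card {a\<in>A1. R a b} + of_bool (R a b)" if "b \<in> B" for b
    proof (cases "R a b")
      case True
      then have "{a\<in>A. R a b} = insert a {a\<in>A1. R a b}"
        using a A1_def by auto
      then show ?thesis using True fin A1_def by simp
    next
      case False
      then have "{a\<in>A. R a b} = {a\<in>A1. R a b}" using A1_def by auto
      then show ?thesis using False by simp
    qed
    have "(\<Sum>b\<in>B. card {a\<in>A. R a b}) = (\<Sum>b\<in>B. card {a\<in>A1. R a b}) + card {b\<in>B. R a b}"
      using split fin by (simp add: sum.distrib Int_def)
    moreover have cA: "card A = Suc (card A1)"
      using a fin A1_def by (metis card.remove)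
    ultimately have "(\<Sum>b\<in>B. card {a\<in>A1. R a b}) > p * card A1 + q * card B"
      using less.prems(3) a by simp
    then have "\<exists>A' B'. A' \<subseteq> A1 \<and> B' \<subseteq> B \<and> A' \<noteq> {} \<and> (\<forall>a\<in>A'. card {b\<in>B'. R a b} > p)
      \<and> (\<forall>b\<in>B'. card {a\<in>A'. R a b} > q)"
      by (intro less.hyps) (use fin cA fA1 in simp_all)
    then obtain A' B' where *: "A' \<subseteq> A1" "B' \<subseteq> B" "A' \<noteq> {}"
      "\<forall>a\<in>A'. card {b\<in>B'. R a b} > p" "\<forall>b\<in>B'. card {a\<in>A'. R a b} > q"
      by (elim exE conjE) (rule that)
    have "A' \<subseteq> A" using *(1) A1_def by blast
    then show ?thesis using * by (intro exI[of _ A'] exI[of _ B'] conjI)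
  next
    case b
    define B1 where "B1 = B - {b}"
    have fB1: "finite B1" using fin B1_def by simp
    have "(\<Sum>b\<in>B. card {a\<in>A. R a b}) = card {a\<in>A. R a b} + (\<Sum>b\<in>B1. card {a\<in>A. R a b})"
      using b fin by (simp add: sum.remove B1_def)
    moreover have cB: "card B = Suc (card B1)"
      using b fin unfolding B1_def by (metis card.remove)
    ultimately have "(\<Sum>b\<in>B1. card {a\<in>A. R a b}) > p * card A + q * card B1"
      using less.prems(3) b by simp
    then have "\<exists>A' B'. A' \<subseteq> A \<and> B' \<subseteq> B1 \<and> A' \<noteq> {} \<and> (\<forall>a\<in>A'. card {b\<in>B'. R a b} > p)
      \<and> (\<forall>b\<in>B'. card {a\<in>A'. R a b} > q)"
      by (intro less.hyps) (use fin cB fB1 in simp_all)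
    then obtain A' B' where *: "A' \<subseteq> A" "B' \<subseteq> B1" "A' \<noteq> {}"
      "\<forall>a\<in>A'. card {b\<in>B'. R a b} > p" "\<forall>b\<in>B'. card {a\<in>A'. R a b} > q"
      by (elim exE conjE) (rule that)
    have "B' \<subseteq> B" using *(2) B1_def by blast
    then show ?thesis using * by (intro exI[of _ A'] exI[of _ B'] conjI)
  next
    case none
    have "A \<noteq> {}" using less.prems(3) by auto
    then show ?thesis using none by (intro exI[of _ A] exI[of _ B]) simp
  qed
qed

text \<open>Greedy extension at the head, two vertices at a time. For disjoint A and B a path on
  2j+1 vertices uses only j vertices of B and j+1 of A, so p = k-1 and q = k suffice; if they may
  overlap, every used vertex has to be counted, whence 2k. The cardinality clause carries the sharp
  count through the induction.\<close>

lemma alternating_path: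
  fixes A B :: "nat set"
  assumes sym: "\<And>u v. G u v \<Longrightarrow> G v u"
    and fin: "finite A" "finite B" and "A \<noteq> {}"
    and degA: "\<And>a. a \<in> A \<Longrightarrow> card {b\<in>B. G a b} > p"
    and degB: "\<And>b. b \<in> B \<Longrightarrow> card {a\<in>A. G a b} > q"
    and pq: "A \<inter> B = {} \<and> k \<le> p + 1 \<and> k \<le> q \<or> 2 * k \<le> p \<and> 2 * k \<le> q"
    and "j \<le> k"
  shows "\<exists>xs. length xs = 2 * j + 1 \<and> distinct xs \<and> successively G xs \<and> hd xs \<in> A
    \<and> last xs \<in> A \<and> set xs \<subseteq> A \<union> B
    \<and> (A \<inter> B = {} \<longrightarrow> card (set xs \<inter> A) = j + 1 \<and> card (set xs \<inter> B) = j)"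
  using \<open>j \<le> k\<close>
proof (induction j)
  case 0
  obtain a where a: "a \<in> A" using \<open>A \<noteq> {}\<close> by blast
  have "card (set [a] \<inter> A) = 0 + 1 \<and> card (set [a] \<inter> B) = 0" if "A \<inter> B = {}"
  proof -
    have "set [a] \<inter> A = {a}" "set [a] \<inter> B = {}" using a that by auto
    then show ?thesis by simp
  qed
  moreover have "length [a] = 2 * 0 + 1" "distinct [a]" "successively G [a]" "hd [a] \<in> A"
    "last [a] \<in> A" "set [a] \<subseteq> A \<union> B" using a by simp_all
  ultimately show ?case by (intro exI[of _ "[a]"] conjI impI) simp_all
next
  case (Suc j)
  then obtain xs where xs: "length xs = 2 * j + 1" "distinct xs" "successively G xs" "hd xs \<in> A"
    "last xs \<in> A" "set xs \<subseteq> A \<union> B"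
    "A \<inter> B = {} \<longrightarrow> card (set xs \<inter> A) = j + 1 \<and> card (set xs \<inter> B) = j"
    by auto
  have cx: "card (set xs) = 2 * j + 1" using xs by (simp add: distinct_card)
  have "card (set xs \<inter> B) \<le> p"
  proof (cases "A \<inter> B = {} \<and> k \<le> p + 1 \<and> k \<le> q")
    case True then show ?thesis using xs(7) Suc.prems by auto
  next
    case False
    have "card (set xs \<inter> B) \<le> card (set xs)" by (intro card_mono) auto
    then show ?thesis using False pq cx Suc.prems by auto
  qed
  then have "\<not> {b\<in>B. G (hd xs) b} \<subseteq> set xs \<inter> B"
    using degA[OF xs(4)] card_mono[of "set xs \<inter> B" "{b\<in>B. G (hd xs) b}"] by force
  then obtain b where b: "b \<in> B" "G (hd xs) b" "b \<notin> set xs" by blast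
  have "card ((insert b (set xs)) \<inter> A) \<le> q"
  proof (cases "A \<inter> B = {} \<and> k \<le> p + 1 \<and> k \<le> q")
    case True
    then have "insert b (set xs) \<inter> A = set xs \<inter> A" using b by auto
    then show ?thesis using True xs(7) Suc.prems by auto
  next
    case False
    have "card (insert b (set xs) \<inter> A) \<le> card (insert b (set xs))" by (intro card_mono) auto
    also have "\<dots> = 2 * j + 2" using b cx by simp
    finally show ?thesis using False pq cx Suc.prems by auto
  qed
  then have "\<not> {a\<in>A. G a b} \<subseteq> insert b (set xs) \<inter> A"
    using degB[OF b(1)] card_mono[of "insert b (set xs) \<inter> A" "{a\<in>A. G a b}"] by force
  then obtain a where a: "a \<in> A" "G a b" "a \<notin> insert b (set xs)" by blast
  have ne: "xs \<noteq> []" using xs(1) by auto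
  have "A \<inter> B = {} \<longrightarrow> card (set (a # b # xs) \<inter> A) = Suc j + 1 \<and> card (set (a # b # xs) \<inter> B) = Suc j"
  proof
    assume d: "A \<inter> B = {}"
    have "set (a # b # xs) \<inter> A = insert a (set xs \<inter> A)" "set (a # b # xs) \<inter> B = insert b (set xs \<inter> B)"
      using a b d by auto
    then show "card (set (a # b # xs) \<inter> A) = Suc j + 1 \<and> card (set (a # b # xs) \<inter> B) = Suc j"
      using a b xs(7) d by simp
  qed
  moreover have "successively G (a # b # xs)"
    using a b xs ne by (simp add: successively_Cons sym)
  moreover have "length (a # b # xs) = 2 * Suc j + 1" using xs(1) by simp
  moreover have "distinct (a # b # xs)" using a b xs(2) by simp
  moreover have "hd (a # b # xs) \<in> A" using a by simp
  moreover have "last (a # b # xs) \<in> A" using xs(5) ne by simp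
  moreover have "set (a # b # xs) \<subseteq> A \<union> B" using xs(6) a(1) b(1) by simp
  ultimately show ?case by (intro exI[of _ "a # b # xs"] conjI)
qed

lemma edge_count_nbhd:
  assumes g: "graph_on n G" and free: "\<not> has_cycle G (2 * k + 2)"
    and A: "A \<subseteq> nbrs G v" and B: "finite B" "v \<notin> B"
    and pq: "A \<inter> B = {} \<and> k \<le> p + 1 \<and> k \<le> q \<or> 2 * k \<le> p \<and> 2 * k \<le> q"
    and k: "k \<ge> 1"
  shows "(\<Sum>b\<in>B. card (A \<inter> nbrs G b)) \<le> p * card A + q * card B"
proof (rule ccontr)
  have "G a b = G b a" for a b
    by (rule iffI) (rule graph_onD(4)[OF g], assumption)+
  then have eq: "A \<inter> nbrs G b = {a\<in>A. G a b}" for b unfolding nbrs_def by auto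
  have fA: "finite A" using A finite_nbrs[OF g] finite_subset by blast
  assume "\<not> ?thesis"
  then have "(\<Sum>b\<in>B. card {a\<in>A. G a b}) > p * card A + q * card B" by (simp only: eq not_le)
  from dense_pair_core[OF fA B(1) this] obtain A' B' where AB: "A' \<subseteq> A" "B' \<subseteq> B" "A' \<noteq> {}"
    and deg: "\<forall>a\<in>A'. card {b\<in>B'. G a b} > p" "\<forall>b\<in>B'. card {a\<in>A'. G a b} > q"
    by (elim exE conjE) (rule that)
  note AB = AB bspec[OF deg(1)] bspec[OF deg(2)]
  have fin: "finite A'" "finite B'" using AB fA B finite_subset by blast+
  have "A' \<inter> B' = {} \<and> k \<le> p + 1 \<and> k \<le> q \<or> 2 * k \<le> p \<and> 2 * k \<le> q"
    using pq AB by blast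
  then have "\<exists>xs. length xs = 2 * k + 1 \<and> distinct xs \<and> successively G xs \<and> hd xs \<in> A'
    \<and> last xs \<in> A' \<and> set xs \<subseteq> A' \<union> B'
    \<and> (A' \<inter> B' = {} \<longrightarrow> card (set xs \<inter> A') = k + 1 \<and> card (set xs \<inter> B') = k)"
    by (rule alternating_path[OF _ fin AB(3) AB(4) AB(5) _ order_refl, rotated 3]) (erule graph_onD(4)[OF g])
  then obtain xs where xs: "length xs = 2 * k + 1" "distinct xs" "successively G xs" "hd xs \<in> A'"
    "last xs \<in> A'" "set xs \<subseteq> A' \<union> B'"
    by (elim exE conjE) (rule that)
  have sub: "A' \<subseteq> nbrs G v" using AB(1) A by (rule subset_trans)
  have "v \<notin> nbrs G v" using graph_onD(3)[OF g, of v v] by (auto simp: nbrs_def)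
  \<comment> \<open>v is to be the closing vertex, so it has to be off the path: it is no neighbour
    of itself and lies outside B.\<close>
  then have v: "v \<notin> set xs" using sub xs(6) AB(2) B(2) by (meson Un_iff subsetD)
  have h: "G v (hd xs)" using subsetD[OF sub xs(4)] by (simp add: nbrs_def)
  have "G v (last xs)" using subsetD[OF sub xs(5)] by (simp add: nbrs_def)
  then have l: "G (last xs) v" by (rule graph_onD(4)[OF g])
  have ne: "xs \<noteq> []" using xs(1) by auto
  have "has_cycle G (2 * k + 2)"
  proof (rule has_cycleI)
    show "length (v # xs) = 2 * k + 2" using xs(1) by simp
    show "distinct (v # xs)" using xs(2) v by simp
    show "successively G (v # xs)" using xs(3) h by (simp add: successively_Cons)
    show "G (last (v # xs)) (hd (v # xs))" using l ne by simp
  qed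
  then show False using free by contradiction
qed

text \<open>N(v) is split along B. Its part inside B has at most |B| vertices, so the crude bound
  costs at most 4k|B| there, and deg v keeps the coefficient k-1.\<close>

lemma codeg_sum_small_set:
  assumes g: "graph_on n G" and free: "\<not> has_cycle G (2 * k + 2)" and k: "k \<ge> 1"
    and B: "finite B" "v \<notin> B"
  shows "(\<Sum>b\<in>B. codeg G v b) \<le> (k - 1) * card (nbrs G v) + 5 * k * card B"
proof -
  let ?A1 = "nbrs G v - B" and ?A2 = "nbrs G v \<inter> B"
  have f: "finite (nbrs G v)" using finite_nbrs[OF g] .
  have split: "codeg G v b = card (?A1 \<inter> nbrs G b) + card (?A2 \<inter> nbrs G b)" for b
  proof -
    have "nbrs G v \<inter> nbrs G b = (?A1 \<inter> nbrs G b) \<union> (?A2 \<inter> nbrs G b)" by blast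
    moreover have "(?A1 \<inter> nbrs G b) \<inter> (?A2 \<inter> nbrs G b) = {}" by blast
    ultimately show ?thesis unfolding codeg_def using f by (metis card_Un_disjoint finite_Diff finite_Int)
  qed
  have 1: "(\<Sum>b\<in>B. card (?A1 \<inter> nbrs G b)) \<le> (k - 1) * card ?A1 + k * card B"
    by (rule edge_count_nbhd[OF g free _ B]) (use k in auto)
  have 2: "(\<Sum>b\<in>B. card (?A2 \<inter> nbrs G b)) \<le> 2 * k * card ?A2 + 2 * k * card B"
    by (rule edge_count_nbhd[OF g free _ B]) (use k in auto)
  have "card ?A1 \<le> card (nbrs G v)" "card ?A2 \<le> card B" using f B by (simp_all add: card_mono)
  then have "(k - 1) * card ?A1 \<le> (k - 1) * card (nbrs G v)" "2 * k * card ?A2 \<le> 2 * k * card B"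
    by simp_all
  then have "(k - 1) * card ?A1 + k * card B + (2 * k * card ?A2 + 2 * k * card B)
      \<le> (k - 1) * card (nbrs G v) + k * card B + (2 * k * card B + 2 * k * card B)"
    by (intro add_mono order_refl)
  with add_mono[OF 1 2] show ?thesis unfolding split sum.distrib by simp
qed

text \<open>Here B is split along N(v) instead, so the crude bound is charged to deg v and |B| keeps
  the coefficient k. The vertex v is split off because \<open>edge_count_nbhd\<close> excludes it;
  its term is deg v.\<close>

lemma codeg_sum:
  assumes g: "graph_on n G" and free: "\<not> has_cycle G (2 * k + 2)" and k: "k \<ge> 1"
    and B: "finite B"
  shows "(\<Sum>b\<in>B. codeg G v b) \<le> 6 * k * card (nbrs G v) + k * card B"
proof -
  let ?N = "nbrs G v"
  let ?B1 = "B - ?N - {v}" and ?B2 = "B \<inter> ?N" and ?B3 = "B \<inter> {v}"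
  have f: "finite ?N" using finite_nbrs[OF g] .
  have vN: "v \<notin> ?N" using graph_onD(3)[OF g, of v v] unfolding nbrs_def by blast
  have "B = (?B1 \<union> ?B2) \<union> ?B3" by blast
  then have "(\<Sum>b\<in>B. codeg G v b) = (\<Sum>b\<in>(?B1 \<union> ?B2) \<union> ?B3. codeg G v b)" by simp
  also have "\<dots> = (\<Sum>b\<in>?B1 \<union> ?B2. codeg G v b) + (\<Sum>b\<in>?B3. codeg G v b)"
    by (rule sum.union_disjoint) (use B vN in auto)
  also have "(\<Sum>b\<in>?B1 \<union> ?B2. codeg G v b) = (\<Sum>b\<in>?B1. codeg G v b) + (\<Sum>b\<in>?B2. codeg G v b)"
    by (rule sum.union_disjoint) (use B in auto)
  finally have eq: "(\<Sum>b\<in>B. codeg G v b) = (\<Sum>b\<in>?B1. codeg G v b) + (\<Sum>b\<in>?B2. codeg G v b) + (\<Sum>b\<in>?B3. codeg G v b)" .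
  have 1: "(\<Sum>b\<in>?B1. codeg G v b) \<le> (k - 1) * card ?N + k * card ?B1" unfolding codeg_def
    by (rule edge_count_nbhd[OF g free]) (use k B in auto)
  have 2: "(\<Sum>b\<in>?B2. codeg G v b) \<le> 2 * k * card ?N + 2 * k * card ?B2" unfolding codeg_def
    by (rule edge_count_nbhd[OF g free]) (use k B vN in auto)
  have 3: "(\<Sum>b\<in>?B3. codeg G v b) \<le> card ?N"
    by (cases "v \<in> B") (simp_all add: codeg_self)
  have "card ?B1 \<le> card B" by (rule card_mono) (use B in auto)
  then have 4: "k * card ?B1 \<le> k * card B" by simp
  have "card ?B2 \<le> card ?N" by (rule card_mono) (use f in auto)
  then have 5: "2 * k * card ?B2 \<le> 2 * k * card ?N" by simp
  have "(k - 1) * card ?N \<le> k * card ?N" by (intro mult_le_mono1) simp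
  then have 6: "(\<Sum>b\<in>?B1. codeg G v b) \<le> k * card ?N + k * card ?B1"
    using 1 by (meson add_le_mono1 le_trans)
  have 7: "card ?N \<le> k * card ?N" using k by simp
  show ?thesis using 2 3 4 5 6 7 unfolding eq mult.assoc by linarith
qed

section \<open>Perron vector and Rayleigh quotient\<close>

text \<open>The quadratic form y^T A y of the adjacency matrix; each edge enters twice.\<close>

definition qform :: "nat \<Rightarrow> (nat \<Rightarrow> nat \<Rightarrow> bool) \<Rightarrow> (nat \<Rightarrow> real) \<Rightarrow> real" where
  "qform n G y = (\<Sum>i<n. \<Sum>j\<in>nbrs G i. y i * y j)"

lemma sum_nbrs_conv:
  fixes y :: "nat \<Rightarrow> real"
  assumes "graph_on n G"
  shows "(\<Sum>j\<in>nbrs G i. y j) = (\<Sum>j<n. of_bool (G i j) * y j)"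
proof -
  have "(\<Sum>j<n. of_bool (G i j) * y j) = (\<Sum>j\<in>{..<n} \<inter> nbrs G i. y j)"
    by (intro sum.mono_neutral_cong_right) (auto simp: nbrs_def)
  also have "{..<n} \<inter> nbrs G i = nbrs G i" using nbrs_subset[OF assms] by blast
  finally show ?thesis by simp
qed

lemma qform_rows: "qform n G y = (\<Sum>i<n. y i * (\<Sum>j\<in>nbrs G i. y j))"
  by (simp add: qform_def sum_distrib_left)

lemma qform_conv:
  assumes "graph_on n G"
  shows "qform n G y = (\<Sum>i<n. \<Sum>j<n. of_bool (G i j) * y i * y j)"
  unfolding qform_rows sum_nbrs_conv[OF assms] sum_distrib_left
  by (intro sum.cong refl) simp

text \<open>There is no term in t^2 because a graph has no loops. This yields the first-order
  condition at a maximiser, and later the perturbation at a vertex where the Perron vector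
  vanishes.\<close>

lemma qform_upd:
  assumes g: "graph_on n G" and i: "i < n"
  shows "qform n G (y(i := y i + t)) = qform n G y + 2 * t * (\<Sum>j\<in>nbrs G i. y j)"
proof -
  define e :: "nat \<Rightarrow> real" where "e j = of_bool (j = i)" for j
  define a :: "nat \<Rightarrow> nat \<Rightarrow> real" where "a u v = of_bool (G u v)" for u v
  have upd: "y(i := y i + t) = (\<lambda>j. y j + t * e j)" by (auto simp: e_def)
  have sel1: "(\<Sum>u<n. e u * f u) = f i" for f :: "nat \<Rightarrow> real"
  proof -
    have "(\<Sum>u<n. e u * f u) = (\<Sum>u<n. if u = i then f u else 0)"
      by (intro sum.cong) (auto simp: e_def)
    then show ?thesis using i by simp
  qed
  have "a i i = 0" using graph_onD(3)[OF g, of i i] by (auto simp: a_def)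
  have sym: "a u v = a v u" for u v
    using graph_onD(4)[OF g, of u v] graph_onD(4)[OF g, of v u] by (auto simp: a_def)
  have "qform n G (\<lambda>j. y j + t * e j) = (\<Sum>u<n. \<Sum>v<n. a u v * (y u + t * e u) * (y v + t * e v))"
    using qform_conv[OF g] by (simp add: a_def)
  also have "\<dots> = (\<Sum>u<n. \<Sum>v<n. a u v * y u * y v + t * (e v * (a u v * y u)) + t * (e u * (a u v * y v))
      + t * t * (e u * (e v * a u v)))"
    by (intro sum.cong refl) (simp add: algebra_simps)
  also have "\<dots> = (\<Sum>u<n. \<Sum>v<n. a u v * y u * y v) + t * (\<Sum>u<n. \<Sum>v<n. e v * (a u v * y u))
      + t * (\<Sum>u<n. e u * (\<Sum>v<n. a u v * y v)) + t * t * (\<Sum>u<n. e u * (\<Sum>v<n. e v * a u v))"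
    by (simp add: sum.distrib sum_distrib_left)
  also have "(\<Sum>u<n. \<Sum>v<n. a u v * y u * y v) = qform n G y"
    using qform_conv[OF g] by (simp add: a_def)
  also have "(\<Sum>u<n. \<Sum>v<n. e v * (a u v * y u)) = (\<Sum>v<n. a i v * y v)"
    by (simp add: sel1 sym[of _ i])
  also have "(\<Sum>u<n. e u * (\<Sum>v<n. a u v * y v)) = (\<Sum>v<n. a i v * y v)"
    by (rule sel1)
  also have "(\<Sum>u<n. e u * (\<Sum>v<n. e v * a u v)) = 0"
    by (simp add: sel1 \<open>a i i = 0\<close>)
  also have "(\<Sum>v<n. a i v * y v) = (\<Sum>j\<in>nbrs G i. y j)"
    using sum_nbrs_conv[OF g] by (simp add: a_def)
  finally show ?thesis unfolding upd by simp
qed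

lemma qform_abs: "qform n G y \<le> qform n G (\<lambda>i. \<bar>y i\<bar>)"
  unfolding qform_def by (intro sum_mono) (simp flip: abs_mult)

lemma qform_attains_max:
  assumes g: "graph_on n G" and n: "n > 0"
  shows "\<exists>y. (\<Sum>i<n. (y i)\<^sup>2) = 1 \<and> (\<forall>z. qform n G z \<le> qform n G y * (\<Sum>i<n. (z i)\<^sup>2))"
proof -
  \<comment> \<open>Vectors are functions on all of nat, so the coordinates from n on are pinned to
    0. A product of compact factors is compact, and \<open>S\<close> is the unit sphere of R^n
    inside it.\<close>
  define C where "C = PiE UNIV (\<lambda>i. if i < n then {-1..1::real} else {0})"
  define S where "S = C \<inter> {y. (\<Sum>i<n. (y i)\<^sup>2) = 1}"
  have cont[continuous_intros]: "continuous_on A (\<lambda>y::nat \<Rightarrow> real. y i)" for i A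
    by (rule continuous_on_subset[OF continuous_on_product_coordinates]) simp
  have "compactin (product_topology (\<lambda>i. euclidean) UNIV) C"
    unfolding C_def compactin_PiE by auto
  then have "compact C" by (simp add: euclidean_product_topology)
  moreover have "closed {y::nat \<Rightarrow> real. (\<Sum>i<n. (y i)\<^sup>2) = 1}"
    by (intro closed_Collect_eq continuous_intros)
  ultimately have "compact S" unfolding S_def by (rule compact_Int_closed)
  have norm_le: "\<bar>y i\<bar> \<le> 1" if "(\<Sum>i<n. (y i)\<^sup>2) = 1" "i < n" for y :: "nat \<Rightarrow> real" and i
  proof -
    have "(y i)\<^sup>2 \<le> (\<Sum>i<n. (y i)\<^sup>2)" by (rule member_le_sum) (use that in auto)
    then show ?thesis using that by (simp add: abs_square_le_1)
  qed
  have "(\<lambda>i. of_bool (i = 0)) \<in> S" unfolding S_def C_def using n by (auto simp: of_bool_def if_distrib[of "\<lambda>x. x ^ 2"] cong: if_cong)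
  then have "S \<noteq> {}" by blast
  have "continuous_on S (\<lambda>y. qform n G y)" unfolding qform_conv[OF g]
    by (intro continuous_intros)
  from continuous_attains_sup[OF \<open>compact S\<close> \<open>S \<noteq> {}\<close> this] obtain y
    where y: "y \<in> S" "\<forall>z\<in>S. qform n G z \<le> qform n G y" by blast
  have "qform n G z \<le> qform n G y * (\<Sum>i<n. (z i)\<^sup>2)" for z
  proof (cases "(\<Sum>i<n. (z i)\<^sup>2) = 0")
    case True
    then have "\<And>i. i < n \<Longrightarrow> z i = 0" by (simp add: sum_nonneg_eq_0_iff)
    then have "qform n G z = 0" unfolding qform_conv[OF g] by simp
    then show ?thesis using True by simp
  next
    case False
    define s where "s = sqrt (\<Sum>i<n. (z i)\<^sup>2)"
    have s2: "s * s = (\<Sum>i<n. (z i)\<^sup>2)" unfolding s_def by (simp add: sum_nonneg)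
    have s0: "s \<noteq> 0" using False s2 by auto
    define u where "u i = (if i < n then z i / s else 0)" for i
    have u1: "(\<Sum>i<n. (u i)\<^sup>2) = 1"
    proof -
      have "(\<Sum>i<n. (u i)\<^sup>2) = (\<Sum>i<n. (z i)\<^sup>2) / (s * s)"
        unfolding sum_divide_distrib by (intro sum.cong) (auto simp: u_def power2_eq_square)
      then show ?thesis using s2 False by simp
    qed
    have "-1 \<le> u i" "u i \<le> 1" if "i < n" for i using norm_le[OF u1 that] by simp_all
    moreover have "u i = 0" if "\<not> i < n" for i using that by (simp add: u_def)
    ultimately have "u \<in> C" unfolding C_def by auto
    then have "qform n G u \<le> qform n G y" using y u1 by (simp add: S_def)
    moreover have "qform n G z = s * s * qform n G u"
      unfolding qform_conv[OF g] sum_distrib_left using s0 by (intro sum.cong) (auto simp: u_def)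
    ultimately show ?thesis unfolding s2[symmetric] using mult_left_mono[of _ _ "s*s"]
      by (metis mult.commute zero_le_square)
  qed
  then show ?thesis using y by (intro exI[of _ y]) (simp add: S_def)
qed

text \<open>Absolute values of a maximiser again form a maximiser, and stationarity in each single
  coordinate is the eigenvalue equation.\<close>

lemma qform_max_eigenvector:
  assumes g: "graph_on n G" and n: "n > 0"
  shows "\<exists>\<mu> x. \<mu> \<ge> 0 \<and> (\<forall>i. 0 \<le> x i) \<and> (\<Sum>i<n. (x i)\<^sup>2) = 1
    \<and> (\<forall>i<n. (\<Sum>j\<in>nbrs G i. x j) = \<mu> * x i) \<and> (\<forall>z. qform n G z \<le> \<mu> * (\<Sum>i<n. (z i)\<^sup>2))"
proof -
  obtain y where y1: "(\<Sum>i<n. (y i)\<^sup>2) = 1"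
    and ymax: "\<And>z. qform n G z \<le> qform n G y * (\<Sum>i<n. (z i)\<^sup>2)"
    using qform_attains_max[OF g n] by (elim exE conjE) (rule that, auto)
  define x where "x i = \<bar>y i\<bar>" for i
  define \<mu> where "\<mu> = qform n G y"
  have x1: "(\<Sum>i<n. (x i)\<^sup>2) = 1" using y1 by (simp add: x_def)
  have qx: "qform n G x = \<mu>"
    using ymax[of x] qform_abs[of n G y] x1 by (simp add: x_def \<mu>_def flip: x_def)
  have x0: "0 \<le> x i" for i by (simp add: x_def)
  have "\<mu> \<ge> 0" unfolding qx[symmetric] qform_def using x0 by (intro sum_nonneg) simp
  moreover have "(\<Sum>j\<in>nbrs G i. x j) = \<mu> * x i" if i: "i < n" for i
  proof -
    define c where "c = (\<Sum>j\<in>nbrs G i. x j) - \<mu> * x i"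
    \<comment> \<open>The inequality below is tested at t = c / m, which turns it into c^2 (\<mu> +
      2) \<le> 0. Adding 1 keeps the divisor positive when \<mu> = 0.\<close>
    define m where "m = \<mu> + 1"
    have ineq: "2 * t * c \<le> \<mu> * t\<^sup>2" for t
    proof -
      have "(\<Sum>j<n. ((x(i := x i + t)) j)\<^sup>2) = (x i + t)\<^sup>2 + (\<Sum>j\<in>{..<n}-{i}. (x j)\<^sup>2)"
        using i by (subst sum.remove[of _ i]) (auto intro!: sum.cong)
      also have "(\<Sum>j\<in>{..<n}-{i}. (x j)\<^sup>2) = 1 - (x i)\<^sup>2"
        using x1 i by (subst (asm) sum.remove[of _ i]) auto
      finally have "(\<Sum>j<n. ((x(i := x i + t)) j)\<^sup>2) = 1 + 2 * t * x i + t\<^sup>2"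
        by (simp add: power2_eq_square algebra_simps)
      then have "\<mu> + 2 * t * (\<Sum>j\<in>nbrs G i. x j) \<le> \<mu> * (1 + 2 * t * x i + t\<^sup>2)"
        using ymax[of "x(i := x i + t)"] qform_upd[OF g i, of x t] qx by (simp add: \<mu>_def)
      then show ?thesis by (simp add: c_def algebra_simps)
    qed
    have m: "m > 0" using \<open>\<mu> \<ge> 0\<close> by (simp add: m_def)
    have "2 * (c / m) * c * m\<^sup>2 \<le> \<mu> * (c / m)\<^sup>2 * m\<^sup>2"
      by (intro mult_right_mono ineq) simp
    then have "2 * c\<^sup>2 * m \<le> \<mu> * c\<^sup>2" using m by (simp add: power2_eq_square field_simps)
    then have "c\<^sup>2 * (\<mu> + 2) \<le> 0" by (simp add: m_def algebra_simps)
    then have "c = 0" using \<open>\<mu> \<ge> 0\<close> by (simp add: mult_le_0_iff)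
    then show ?thesis by (simp add: c_def)
  qed
  ultimately show ?thesis using x0 x1 ymax by (intro exI[of _ \<mu>] exI[of _ x]) (simp add: \<mu>_def)
qed

section \<open>The Rayleigh maximum as spectral radius of the complex adjacency matrix\<close>

lemma adj_matrix_carrier: "adj_matrix n G \<in> carrier_mat n n"
  by (simp add: adj_matrix_def)

lemma adj_matrix_mult_index:
  assumes "v \<in> carrier_vec n" "i < n"
  shows "(adj_matrix n G *\<^sub>v v) $ i = (\<Sum>j<n. of_bool (G i j) * v $ j)"
proof -
  have "(adj_matrix n G *\<^sub>v v) $ i = (\<Sum>j\<in>{0..<n}. adj_matrix n G $$ (i, j) * v $ j)"
    using assms by (simp add: adj_matrix_def scalar_prod_def)
  also have "\<dots> = (\<Sum>j<n. of_bool (G i j) * v $ j)"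
    using assms(2) by (intro sum.cong) (auto simp: adj_matrix_def)
  finally show ?thesis .
qed

text \<open>One inequality holds since x is itself an eigenvector. For the other, take the moduli z
  of a complex eigenvector for \<nu>: by the triangle inequality |\<nu>| z_i is at most the row sum
  of z at i, so |\<nu>| is at most a Rayleigh quotient.\<close>

lemma graph_spectral_radius_eqI:
  assumes g: "graph_on n G" and n: "n > 0" and mu: "\<mu> \<ge> 0" and x1: "(\<Sum>i<n. (x i)\<^sup>2) = 1"
    and eig: "\<And>i. i < n \<Longrightarrow> (\<Sum>j\<in>nbrs G i. x j) = \<mu> * x i"
    and max: "\<And>z. qform n G z \<le> \<mu> * (\<Sum>i<n. (z i)\<^sup>2)"
  shows "graph_spectral_radius n G = \<mu>"
proof (rule antisym)
  let ?A = "adj_matrix n G"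
  note A = adj_matrix_carrier[of n G]
  define v where "v = vec n (\<lambda>i. complex_of_real (x i))"
  have v: "v \<in> carrier_vec n" by (simp add: v_def)
  have "?A *\<^sub>v v = complex_of_real \<mu> \<cdot>\<^sub>v v"
  proof (rule eq_vecI)
    fix i assume "i < dim_vec (complex_of_real \<mu> \<cdot>\<^sub>v v)"
    then have i: "i < n" by (simp add: v_def)
    have "(?A *\<^sub>v v) $ i = complex_of_real (\<Sum>j<n. of_bool (G i j) * x j)"
      unfolding adj_matrix_mult_index[OF v i] by (simp add: v_def)
    also have "\<dots> = complex_of_real (\<mu> * x i)"
      using eig[OF i] sum_nbrs_conv[OF g] by simp
    finally show "(?A *\<^sub>v v) $ i = (complex_of_real \<mu> \<cdot>\<^sub>v v) $ i" using i by (simp add: v_def)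
  qed (use A v in auto)
  moreover have "v \<noteq> 0\<^sub>v n"
  proof
    assume "v = 0\<^sub>v n"
    then have "v $ i = 0" if "i < n" for i using that by simp
    then have "x i = 0" if "i < n" for i using that by (simp add: v_def)
    then show False using x1 by simp
  qed
  ultimately have "complex_of_real \<mu> \<in> spectrum ?A"
    unfolding spectrum_def eigenvalue_def eigenvector_def using v A by auto
  then have "\<mu> \<in> norm ` spectrum ?A" using mu by (metis abs_of_nonneg image_eqI norm_of_real)
  then show "\<mu> \<le> graph_spectral_radius n G"
    unfolding graph_spectral_radius_def by (rule spectral_radius_mem_max(2)[OF A n])
  from spectral_radius_mem_max(1)[OF A n] obtain \<nu> where nu: "\<nu> \<in> spectrum ?A"
    "graph_spectral_radius n G = norm \<nu>" unfolding graph_spectral_radius_def by blast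
  then obtain u where u: "u \<in> carrier_vec n" "u \<noteq> 0\<^sub>v n" "?A *\<^sub>v u = \<nu> \<cdot>\<^sub>v u"
    using A unfolding spectrum_def eigenvalue_def eigenvector_def by auto
  define z where "z i = norm (u $ i)" for i
  have row: "norm \<nu> * z i \<le> (\<Sum>j\<in>nbrs G i. z j)" if i: "i < n" for i
  proof -
    have "norm \<nu> * z i = norm ((\<nu> \<cdot>\<^sub>v u) $ i)" using i u(1) by (simp add: z_def norm_mult)
    also have "\<dots> = norm (\<Sum>j<n. of_bool (G i j) * u $ j)"
      unfolding u(3)[symmetric] adj_matrix_mult_index[OF u(1) i] ..
    also have "\<dots> \<le> (\<Sum>j<n. norm (of_bool (G i j) * u $ j))" by (rule norm_sum)
    also have "\<dots> = (\<Sum>j<n. of_bool (G i j) * z j)"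
      by (intro sum.cong) (auto simp: z_def)
    finally show ?thesis using sum_nbrs_conv[OF g] by simp
  qed
  have "norm \<nu> * (\<Sum>i<n. (z i)\<^sup>2) = (\<Sum>i<n. z i * (norm \<nu> * z i))"
    by (simp add: sum_distrib_left power2_eq_square mult_ac)
  also have "\<dots> \<le> qform n G z" unfolding qform_rows
    by (intro sum_mono mult_left_mono row) (auto simp: z_def)
  also have "\<dots> \<le> \<mu> * (\<Sum>i<n. (z i)\<^sup>2)" by (rule max)
  finally have le: "norm \<nu> * (\<Sum>i<n. (z i)\<^sup>2) \<le> \<mu> * (\<Sum>i<n. (z i)\<^sup>2)" .
  have "\<exists>i<n. z i \<noteq> 0"
  proof (rule ccontr)
    assume "\<not> ?thesis"
    then have "u = 0\<^sub>v n" using u(1) by (intro eq_vecI) (auto simp: z_def)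
    then show False using u(2) by simp
  qed
  then have "(\<Sum>i<n. (z i)\<^sup>2) > 0"
    by (metis (mono_tags, lifting) finite_lessThan lessThan_iff sum_pos2 zero_le_power2 zero_less_power2)
  then show "graph_spectral_radius n G \<le> \<mu>" using le nu(2) by simp
qed

lemma rayleigh_bound:
  assumes g: "graph_on n G" and n: "n > 0"
  shows "qform n G z \<le> graph_spectral_radius n G * (\<Sum>i<n. (z i)\<^sup>2)"
proof -
  obtain \<mu> x where mx: "\<mu> \<ge> 0" "(\<Sum>i<n. (x i)\<^sup>2) = 1"
    "\<forall>i<n. (\<Sum>j\<in>nbrs G i. x j) = \<mu> * x i" "\<forall>z. qform n G z \<le> \<mu> * (\<Sum>i<n. (z i)\<^sup>2)"
    using qform_max_eigenvector[OF g n] by (elim exE conjE) (rule that)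
  have "graph_spectral_radius n G = \<mu>"
    by (rule graph_spectral_radius_eqI[OF g n mx(1,2)]) (use mx(3,4) in auto)
  then show ?thesis using mx(4) by simp
qed

lemma perron_vector:
  assumes g: "graph_on n G" and n: "n > 0"
  shows "\<exists>x w. (\<forall>i. 0 \<le> x i) \<and> (\<forall>i<n. x i \<le> (1::real)) \<and> w < n \<and> x w = 1
    \<and> (\<forall>i<n. (\<Sum>j\<in>nbrs G i. x j) = graph_spectral_radius n G * x i) \<and> graph_spectral_radius n G \<ge> 0"
proof -
  obtain \<mu> x where mx: "\<mu> \<ge> 0" "\<forall>i. 0 \<le> x i" "(\<Sum>i<n. (x i)\<^sup>2) = 1"
    "\<forall>i<n. (\<Sum>j\<in>nbrs G i. x j) = \<mu> * x i" "\<forall>z. qform n G z \<le> \<mu> * (\<Sum>i<n. (z i)\<^sup>2)"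
    using qform_max_eigenvector[OF g n] by (elim exE conjE) (rule that)
  have mu: "graph_spectral_radius n G = \<mu>"
    by (rule graph_spectral_radius_eqI[OF g n mx(1,3)]) (use mx(4,5) in auto)
  have "finite (x ` {..<n})" "x ` {..<n} \<noteq> {}" using n by auto
  from Max_in[OF this] obtain w where w: "w < n" "x w = Max (x ` {..<n})" by auto
  have wmax: "x i \<le> x w" if "i < n" for i unfolding w(2) using that by (intro Max_ge) auto
  have "x w > 0"
  proof (rule ccontr)
    assume "\<not> x w > 0"
    then have "x i = 0" if "i < n" for i using wmax[OF that] mx(2) by (metis leD order.order_iff_strict order.strict_trans2)
    then show False using mx(3) by simp
  qed
  show ?thesis
  proof (intro exI[of _ "\<lambda>i. x i / x w"] exI[of _ w] conjI allI impI)
    show "0 \<le> x i / x w" for i using mx(2) \<open>x w > 0\<close> by simp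
    show "x i / x w \<le> 1" if "i < n" for i using wmax[OF that] \<open>x w > 0\<close> by simp
    show "w < n" by fact
    show "x w / x w = 1" using \<open>x w > 0\<close> by simp
    show "(\<Sum>j\<in>nbrs G i. x j / x w) = graph_spectral_radius n G * (x i / x w)" if "i < n" for i
      using mx(4) that unfolding mu by (simp flip: sum_divide_distrib)
    show "graph_spectral_radius n G \<ge> 0" using mu mx(1) by simp
  qed
qed

section \<open>Walks of length two\<close>

lemma walk2:
  assumes g: "graph_on n G" and eig: "\<And>i. i < n \<Longrightarrow> (\<Sum>j\<in>nbrs G i. x j) = l * x i" and v: "v < n"
  shows "l\<^sup>2 * x v = (\<Sum>b<n. real (codeg G v b) * x b)"
proof -
  have "l\<^sup>2 * x v = l * (l * x v)" by (simp add: power2_eq_square)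
  also have "\<dots> = (\<Sum>u\<in>nbrs G v. l * x u)" unfolding eig[OF v, symmetric] by (rule sum_distrib_left)
  also have "\<dots> = (\<Sum>u\<in>nbrs G v. \<Sum>b<n. of_bool (G u b) * x b)"
  proof (rule sum.cong[OF refl])
    fix u assume "u \<in> nbrs G v"
    then have "u < n" using nbrs_subset[OF g] by blast
    from eig[OF this] show "l * x u = (\<Sum>b<n. of_bool (G u b) * x b)" using sum_nbrs_conv[OF g] by metis
  qed
  also have "\<dots> = (\<Sum>b<n. (\<Sum>u\<in>nbrs G v. of_bool (G u b)) * x b)"
    by (subst sum.swap) (simp only: sum_distrib_right)
  also have "\<dots> = (\<Sum>b<n. real (codeg G v b) * x b)"
  proof (rule sum.cong[OF refl])
    fix b
    have "G u b = G b u" for u using graph_onD(4)[OF g, of u b] graph_onD(4)[OF g, of b u] by blast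
    then have "nbrs G v \<inter> {u. G u b} = nbrs G v \<inter> nbrs G b" by (auto simp: nbrs_def)
    then have "(\<Sum>u\<in>nbrs G v. of_bool (G u b)) = real (codeg G v b)"
      using finite_nbrs[OF g] by (simp add: codeg_def)
    then show "(\<Sum>u\<in>nbrs G v. of_bool (G u b)) * x b = real (codeg G v b) * x b" by simp
  qed
  finally show ?thesis .
qed

text \<open>Co-degrees vanish outside Q, so only Q counts in the walks of length two from the vertex
  with entry 1, and deg w \<le> |Q|. It will be applied to the graph induced on a small exceptional
  set.\<close>

lemma spectral_radius_sq_le:
  assumes g: "graph_on n H" and n: "n > 0" and k: "k \<ge> 1" and free: "\<not> has_cycle H (2 * k + 2)"
    and Q: "Q \<subseteq> {..<n}" "\<And>u v. H u v \<Longrightarrow> u \<in> Q"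
  shows "(graph_spectral_radius n H)\<^sup>2 \<le> 7 * real k * real (card Q)"
proof -
  obtain x w where x: "\<forall>i. 0 \<le> x i" "\<forall>i<n. x i \<le> (1::real)" "w < n" "x w = 1"
    and eig: "\<forall>i<n. (\<Sum>j\<in>nbrs H i. x j) = graph_spectral_radius n H * x i"
    using perron_vector[OF g n] by (elim exE conjE) (rule that)
  have fQ: "finite Q" using Q(1) finite_subset by blast
  have "nbrs H b = {}" if "b \<notin> Q" for b using Q(2)[of b] that by (auto simp: nbrs_def)
  then have z: "codeg H w b = 0" if "b \<notin> Q" for b using that by (simp add: codeg_def)
  have "nbrs H w \<subseteq> Q" using Q(2) graph_onD(4)[OF g, of w] by (auto simp: nbrs_def)
  then have d: "card (nbrs H w) \<le> card Q" using fQ by (simp add: card_mono)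
  have "(graph_spectral_radius n H)\<^sup>2 = (\<Sum>b<n. real (codeg H w b) * x b)"
    using walk2[OF g eig[rule_format] x(3)] x(4) by simp
  also have "\<dots> \<le> (\<Sum>b<n. real (codeg H w b))"
    by (intro sum_mono) (simp add: mult_left_le x(2))
  also have "\<dots> = (\<Sum>b\<in>Q. real (codeg H w b))"
    by (rule sum.mono_neutral_right) (use Q z in auto)
  also have "\<dots> = real (\<Sum>b\<in>Q. codeg H w b)" by simp
  also have "\<dots> \<le> real (6 * k * card (nbrs H w) + k * card Q)"
    using codeg_sum[OF g free k fQ] by (rule of_nat_mono)
  also have "\<dots> \<le> real (6 * k * card Q + k * card Q)"
    using d by (intro of_nat_mono add_mono mult_le_mono2) auto
  finally show ?thesis by simp
qed

text \<open>Good vertices alternate with connecting vertices. If N(v) misses the whole path, any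
  common neighbour of v and the head is automatically new. Co-degree two matters only at the end,
  where v must reach both ends of the path through different vertices.\<close>

lemma greedy_even_cycle:
  assumes g: "graph_on n G" and k: "k \<ge> 1" and ne: "good \<noteq> {}"
    and step: "\<And>U a b. finite U \<Longrightarrow> card U \<le> 2 * k + 2 \<Longrightarrow> a \<in> good \<Longrightarrow> b \<in> good \<Longrightarrow>
      \<exists>v\<in>good. v \<notin> U \<and> nbrs G v \<inter> U = {} \<and> codeg G a v \<ge> 2 \<and> codeg G b v \<ge> 2"
  shows "has_cycle G (2 * k + 2)"
proof -
  have ext: "\<exists>xs. length xs = 2 * j + 1 \<and> distinct xs \<and> successively G xs \<and> hd xs \<in> good \<and> last xs \<in> good"
    if "j \<le> k - 1" for j using that
  proof (induction j)
    case 0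
    from ne obtain a where "a \<in> good" by blast
    then show ?case by (intro exI[of _ "[a]"]) simp
  next
    case (Suc j)
    then obtain xs where xs: "length xs = 2 * j + 1" "distinct xs" "successively G xs"
      "hd xs \<in> good" "last xs \<in> good" by auto
    have nn: "xs \<noteq> []" using xs(1) by auto
    have "card (set xs) \<le> 2 * k + 2" using xs Suc.prems by (simp add: distinct_card)
    from step[OF _ this xs(4) xs(4)] obtain v where v: "v \<in> good" "v \<notin> set xs"
      "nbrs G v \<inter> set xs = {}" "codeg G (hd xs) v \<ge> 2" by auto
    then have "nbrs G (hd xs) \<inter> nbrs G v \<noteq> {}" by (auto simp: codeg_def)
    then obtain c where c: "G (hd xs) c" "G v c" by (auto simp: nbrs_def)
    then have "c \<notin> set xs" using v(3) by (auto simp: nbrs_def)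
    moreover have "v \<noteq> c" using graph_onD(3)[OF g c(2)] .
    moreover have "G c (hd xs)" using graph_onD(4)[OF g c(1)] .
    ultimately show ?case using xs v c nn
      by (intro exI[of _ "v # c # xs"]) (simp add: successively_Cons)
  qed
  from ext[OF order_refl] obtain xs where xs: "length xs = 2 * (k - 1) + 1" "distinct xs"
      "successively G xs" "hd xs \<in> good" "last xs \<in> good" by auto
  have nn: "xs \<noteq> []" using xs(1) by auto
  have "card (set xs) \<le> 2 * k + 2" using xs by (simp add: distinct_card)
  from step[OF _ this xs(4) xs(5)] obtain v where v: "v \<in> good" "v \<notin> set xs"
    "nbrs G v \<inter> set xs = {}" "codeg G (hd xs) v \<ge> 2" "codeg G (last xs) v \<ge> 2" by auto
  then have "nbrs G (hd xs) \<inter> nbrs G v \<noteq> {}" by (auto simp: codeg_def)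
  then obtain c where c: "G (hd xs) c" "G v c" by (auto simp: nbrs_def)
  have "\<not> nbrs G (last xs) \<inter> nbrs G v \<subseteq> {c}"
    using v(5) card_mono[of "{c}" "nbrs G (last xs) \<inter> nbrs G v"] by (auto simp: codeg_def)
  then obtain c' where c': "G (last xs) c'" "G v c'" "c' \<noteq> c" by (auto simp: nbrs_def)
  have "c \<notin> set xs" "c' \<notin> set xs" using v(3) c c' by (auto simp: nbrs_def)
  moreover have "v \<noteq> c" "v \<noteq> c'" using graph_onD(3)[OF g c(2)] graph_onD(3)[OF g c'(2)] by auto
  moreover have "G c (hd xs)" "G c' v" using graph_onD(4)[OF g c(1)] graph_onD(4)[OF g c'(2)] by auto
  ultimately show ?thesis using xs v c c' nn k
    by (intro has_cycleI[of "c' # v # c # xs"]) (auto simp: successively_Cons)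
qed

section \<open>Estimates from l^2 >= k n and the absence of C_{2k+2}\<close>

text \<open>Only the even cycle is excluded here; C_{2k+1} enters with \<open>extremal_core\<close>.
  Extremality of G is represented by \<open>l_sq\<close> alone.\<close>

locale extremal =
  fixes k n :: nat and G :: "nat \<Rightarrow> nat \<Rightarrow> bool" and l :: real and x :: "nat \<Rightarrow> real" and w :: nat
  assumes k2: "k \<ge> 2" and n_pos: "n > 0" and graph: "graph_on n G"
    and free: "\<not> has_cycle G (2 * k + 2)"
    and x_nonneg: "\<And>i. 0 \<le> x i" and x_le1: "\<And>i. i < n \<Longrightarrow> x i \<le> 1"
    and w: "w < n" and xw: "x w = 1"
    and eig: "\<And>i. i < n \<Longrightarrow> (\<Sum>j\<in>nbrs G i. x j) = l * x i"
    and l_nonneg: "l \<ge> 0" and l_sq: "real k * real n \<le> l\<^sup>2"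
begin

abbreviation N :: "nat \<Rightarrow> nat set" where "N \<equiv> nbrs G"
abbreviation deg :: "nat \<Rightarrow> real" where "deg v \<equiv> real (card (nbrs G v))"
abbreviation cd :: "nat \<Rightarrow> nat \<Rightarrow> real" where "cd v b \<equiv> real (codeg G v b)"

lemma deg_le: "deg v \<le> real n"
  using card_nbrs_le[OF graph] by simp

lemma cd_sum:
  assumes "finite B"
  shows "(\<Sum>b\<in>B. cd v b) \<le> 6 * real k * deg v + real k * real (card B)"
proof -
  have "real (\<Sum>b\<in>B. codeg G v b) \<le> real (6 * k * card (nbrs G v) + k * card B)"
    using codeg_sum[OF graph free _ assms] k2 by (intro of_nat_mono) simp
  then show ?thesis by simp
qed

lemma cd_sum_small:
  assumes "finite B" "v \<notin> B"
  shows "(\<Sum>b\<in>B. cd v b) \<le> (real k - 1) * deg v + 5 * real k * real (card B)"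
proof -
  have "real (\<Sum>b\<in>B. codeg G v b) \<le> real ((k - 1) * card (nbrs G v) + 5 * k * card B)"
    using codeg_sum_small_set[OF graph free _ assms] k2 by (intro of_nat_mono) simp
  then show ?thesis using k2 by (simp add: of_nat_diff)
qed

lemma cd_weighted:
  assumes "finite B" "c \<ge> 0" "\<And>b. b \<in> B \<Longrightarrow> x b \<le> c"
  shows "(\<Sum>b\<in>B. cd v b * x b) \<le> c * (6 * real k * deg v + real k * real (card B))"
proof -
  have "(\<Sum>b\<in>B. cd v b * x b) \<le> (\<Sum>b\<in>B. c * cd v b)"
  proof (rule sum_mono)
    fix b assume "b \<in> B"
    from mult_left_mono[OF assms(3)[OF this], of "cd v b"] show "cd v b * x b \<le> c * cd v b"
      by (simp add: mult.commute)
  qed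
  also have "\<dots> = c * (\<Sum>b\<in>B. cd v b)" by (simp add: sum_distrib_left)
  also have "\<dots> \<le> c * (6 * real k * deg v + real k * real (card B))"
    using cd_sum[OF assms(1)] assms(2) by (rule mult_left_mono)
  finally show ?thesis .
qed

lemma walks: "v < n \<Longrightarrow> l\<^sup>2 * x v = (\<Sum>b<n. cd v b * x b)"
  using walk2[OF graph eig] by simp

lemma l_sq_le: "l\<^sup>2 \<le> 7 * real k * real n"
proof -
  have "l\<^sup>2 * x w \<le> 1 * (6 * real k * deg w + real k * real (card {..<n}))"
    unfolding walks[OF w] by (rule cd_weighted) (auto simp: x_le1)
  also have "\<dots> \<le> 6 * real k * real n + real k * real n"
    using deg_le[of w] by (simp add: mult_left_mono)
  finally show ?thesis using xw by simp
qed

text \<open>The left side counts walks of length two by their middle vertex; regrouped by end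
  vertices it is the sum of all co-degrees.\<close>

lemma deg_sq_sum: "(\<Sum>u<n. (deg u)\<^sup>2) \<le> 7 * real k * (real n)\<^sup>2"
proof -
  define a where "a u v = (of_bool (G u v) :: real)" for u v
  have sym: "a u v = a v u" for u v
    using graph_onD(4)[OF graph, of u v] graph_onD(4)[OF graph, of v u] by (auto simp: a_def)
  have dg: "(\<Sum>v<n. a u v) = deg u" for u
    using sum_nbrs_conv[OF graph, of "\<lambda>_. 1" u] unfolding a_def by simp
  have cdg: "cd v b = (\<Sum>u<n. a v u * a b u)" for v b
  proof -
    have "(\<Sum>u<n. a v u * a b u) = (\<Sum>u\<in>N v. a b u)"
      using sum_nbrs_conv[OF graph, of "a b" v] unfolding a_def by simp
    also have "\<dots> = cd v b" using finite_nbrs[OF graph]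
      by (simp add: a_def codeg_def nbrs_def)
    finally show ?thesis ..
  qed
  have dg': "(\<Sum>v<n. a v u) = deg u" for u
    unfolding dg[symmetric] by (intro sum.cong refl sym)
  have "(\<Sum>u<n. (deg u)\<^sup>2) = (\<Sum>u<n. \<Sum>v<n. \<Sum>b<n. a v u * a b u)"
    unfolding dg'[symmetric] power2_eq_square sum_product ..
  also have "\<dots> = (\<Sum>v<n. \<Sum>u<n. \<Sum>b<n. a v u * a b u)" by (rule sum.swap)
  also have "\<dots> = (\<Sum>v<n. \<Sum>b<n. cd v b)" unfolding cdg
    by (rule sum.cong[OF refl]) (rule sum.swap)
  also have "\<dots> \<le> (\<Sum>v<n. 7 * real k * real n)"
  proof (rule sum_mono)
    fix v
    have "(\<Sum>b<n. cd v b) \<le> 6 * real k * deg v + real k * real n" using cd_sum[of "{..<n}" v] by simp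
    also have "\<dots> \<le> 6 * real k * real n + real k * real n" using deg_le[of v] by (simp add: mult_left_mono)
    finally show "(\<Sum>b<n. cd v b) \<le> 7 * real k * real n" by simp
  qed
  also have "\<dots> = 7 * real k * (real n)\<^sup>2" by (simp add: power2_eq_square)
  finally show ?thesis .
qed

text \<open>Markov's inequality for the squared degrees: the number of vertices of linear degree is
  bounded independently of n.\<close>

lemma card_hubs:
  assumes "\<delta> > 0"
  shows "real (card {v. v < n \<and> deg v \<ge> \<delta> * real n}) \<le> 7 * real k / \<delta>\<^sup>2"
proof -
  let ?H = "{v. v < n \<and> deg v \<ge> \<delta> * real n}"
  have "real (card ?H) * (\<delta> * real n)\<^sup>2 = (\<Sum>v\<in>?H. (\<delta> * real n)\<^sup>2)" by simp
  also have "\<dots> \<le> (\<Sum>v\<in>?H. (deg v)\<^sup>2)"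
    using assms by (intro sum_mono power_mono) auto
  also have "\<dots> \<le> (\<Sum>v<n. (deg v)\<^sup>2)" by (intro sum_mono2) auto
  also have "\<dots> \<le> 7 * real k * (real n)\<^sup>2" by (rule deg_sq_sum)
  finally have "real (card ?H) * \<delta>\<^sup>2 * (real n)\<^sup>2 \<le> 7 * real k * (real n)\<^sup>2"
    by (simp add: power_mult_distrib mult.assoc)
  then have "real (card ?H) * \<delta>\<^sup>2 \<le> 7 * real k" using n_pos by simp
  then show ?thesis using assms by (simp add: pos_le_divide_eq)
qed

end

section \<open>The largest entry has linear degree\<close>

text \<open>Meant for the error term P of \<open>few_large_entries\<close>, a constant plus a
  multiple of sqrt n.\<close>

lemma ex_nat_dominating_sqrt:
  assumes "c3 > (0::real)" "c2 \<ge> 0"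
  shows "\<exists>M::nat. \<forall>n\<ge>M. c1 + c2 * sqrt (real n) \<le> c3 * real n"
proof -
  define M where "M = nat \<lceil>max (2 * \<bar>c1\<bar> / c3) ((2 * c2 / c3)\<^sup>2)\<rceil>"
  have "c1 + c2 * sqrt (real n) \<le> c3 * real n" if "n \<ge> M" for n
  proof -
    have "max (2 * \<bar>c1\<bar> / c3) ((2 * c2 / c3)\<^sup>2) \<le> real n" using that unfolding M_def by linarith
    then have 1: "2 * \<bar>c1\<bar> / c3 \<le> real n" and 2: "(2 * c2 / c3)\<^sup>2 \<le> real n" by auto
    have "c1 \<le> c3 * real n / 2" using 1 assms(1) by (simp add: field_simps)
    moreover have "2 * c2 / c3 \<le> sqrt (real n)" using 2 by (rule real_le_rsqrt)
    then have "c2 \<le> c3 * sqrt (real n) / 2" using assms(1) by (simp add: field_simps)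
    then have "c2 * sqrt (real n) \<le> c3 * sqrt (real n) / 2 * sqrt (real n)"
      by (rule mult_right_mono) simp
    moreover have "c3 * sqrt (real n) / 2 * sqrt (real n) = c3 * real n / 2" by simp
    ultimately show ?thesis by linarith
  qed
  then show ?thesis by blast
qed

context extremal
begin

lemma max_degree_linear:
  assumes big: "real n \<ge> 200000000 * real k ^ 3"
  shows "deg w \<ge> real n / (2400000 * real k)"
proof (rule ccontr)
  assume neg: "\<not> ?thesis"
  \<comment> \<open>The threshold for hubs. The bound on deg w being refuted is D / 2400, so that
    606 deg w, which bounds the set T of smaller entries, is below D / 2; and 6 k D is negligible
    against k n.\<close>
  define D where "D = real n / (1000 * real k)"
  have kpos: "real k \<ge> 2" using k2 by simp
  have npos: "real n > 0" using n_pos by simp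
  have Dpos: "D > 0" using kpos npos by (simp add: D_def)
  have kD: "real k * D = real n / 1000" using kpos by (simp add: D_def)
  have Dn: "D \<le> real n / 2000" using mult_right_mono[OF kpos, of D] Dpos kD by simp
  have dw: "deg w < D / 2400" using neg by (simp add: D_def not_le)
  define T where "T = {z. z < n \<and> x z < 99/100}"
  have fT: "finite T" "T \<subseteq> {..<n}" by (auto simp: T_def)
  have Tn: "card T \<le> n" using card_mono[OF _ fT(2)] by simp
  define ST where "ST = (\<Sum>b\<in>T. cd w b)"
  define SC where "SC = (\<Sum>b\<in>{..<n}-T. cd w b)"
  \<comment> \<open>The co-degrees at w sum to at most k n + 6 k deg w, while weighted by x they
    still reach k n. Hence those on T sum to at most 600 k deg w, and \<open>cd_sum\<close> on the
    complement of T then bounds |T|.\<close>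
  have cT: "real (card T) \<le> 606 * deg w"
  proof -
    have "l\<^sup>2 = (\<Sum>b\<in>{..<n}-T. cd w b * x b) + (\<Sum>b\<in>T. cd w b * x b)"
      using walks[OF w] xw sum.subset_diff[OF fT(2) finite_lessThan, of "\<lambda>b. cd w b * x b"] by simp
    moreover have "(\<Sum>b\<in>{..<n}-T. cd w b * x b) \<le> SC" unfolding SC_def
      by (intro sum_mono) (simp add: x_le1 mult_left_le)
    moreover have "(\<Sum>b\<in>T. cd w b * x b) \<le> 99/100 * ST" unfolding ST_def sum_distrib_left
    proof (rule sum_mono)
      fix b assume "b \<in> T"
      then have "x b \<le> 99/100" by (simp add: T_def)
      from mult_left_mono[OF this, of "cd w b"] show "cd w b * x b \<le> 99/100 * cd w b" by simp
    qed
    ultimately have a1: "real k * real n \<le> SC + 99/100 * ST" using l_sq by linarith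
    have "ST + SC = (\<Sum>b<n. cd w b)" unfolding ST_def SC_def
      using sum.subset_diff[OF fT(2) finite_lessThan, of "cd w"] by simp
    then have a2: "ST + SC \<le> 6 * (real k * deg w) + real k * real n"
      using cd_sum[of "{..<n}" w] by simp
    have "real (card ({..<n} - T)) = real n - real (card T)"
      using card_Diff_subset[OF fT] Tn by simp
    then have a3: "SC \<le> 6 * (real k * deg w) + real k * (real n - real (card T))"
      using cd_sum[of "{..<n} - T" w] unfolding SC_def by simp
    have "real k * real (card T) \<le> 606 * (real k * deg w)"
      using a1 a2 a3 mult_nonneg_nonneg[of "real k" "deg w"] unfolding right_diff_distrib by linarith
    then have "real k * real (card T) \<le> real k * (606 * deg w)" by simp
    then show ?thesis using kpos by simp
  qed
  have Tsmall: "real (card T) \<le> D / 2" using cT dw by simp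
  \<comment> \<open>A hub would have at least D / 2 neighbours with entries at least 99/100, making
    l linear in n, against l^2 \<le> 7 k n. The contradiction needs n > 112000000 k^3.\<close>
  have no_hub: "deg u \<le> D" for u
  proof (rule ccontr)
    assume "\<not> deg u \<le> D"
    then have hub: "deg u > D" by simp
    have "u < n"
    proof (rule ccontr)
      assume "\<not> u < n"
      then have "N u = {}" using graph_onD(1)[OF graph, of u] by (auto simp: nbrs_def)
      then show False using hub Dpos by simp
    qed
    have "card (N u) \<le> card (N u - T) + card T" using card_Un_le[of "N u - T" T]
      card_mono[of "(N u - T) \<union> T" "N u"] finite_nbrs[OF graph] fT by (auto intro: order_trans)
    then have c: "real (card (N u - T)) \<ge> D / 2" using hub Tsmall by linarith
    have "99/100 * real (card (N u - T)) = (\<Sum>j\<in>N u - T. 99/100)" by simp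
    also have "\<dots> \<le> (\<Sum>j\<in>N u - T. x j)"
      using nbrs_subset[OF graph, of u] by (intro sum_mono) (auto simp: T_def not_less)
    also have "\<dots> \<le> (\<Sum>j\<in>N u. x j)"
      using finite_nbrs[OF graph] x_nonneg by (intro sum_mono2) auto
    also have "\<dots> \<le> l" using eig[OF \<open>u < n\<close>] x_le1[OF \<open>u < n\<close>] l_nonneg by (simp add: mult_left_le)
    finally have "D / 4 \<le> l" using c Dpos by linarith
    then have "(D / 4)\<^sup>2 \<le> l\<^sup>2" using Dpos by (intro power_mono) auto
    then have "D\<^sup>2 \<le> 112 * real k * real n" using l_sq_le by (simp add: power_divide)
    then have "real k ^ 2 * D\<^sup>2 \<le> real k ^ 2 * (112 * real k * real n)" by (intro mult_left_mono) auto
    moreover have "real k ^ 2 * D\<^sup>2 = (real n)\<^sup>2 / 1000000"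
      unfolding power_mult_distrib[symmetric] kD by (simp add: power_divide)
    ultimately have "real n * real n \<le> real n * (112000000 * real k ^ 3)"
      by (simp add: power2_eq_square power3_eq_cube mult_ac)
    then have "real n \<le> 112000000 * real k ^ 3" using npos by simp
    moreover have "real k ^ 3 > 0" using kpos by simp
    ultimately show False using big by linarith
  qed
  define Z where "Z a = {z. z < n \<and> codeg G a z \<le> 1}" for a
  have fZ: "finite (Z a)" "Z a \<subseteq> {..<n}" for a by (auto simp: Z_def)
  \<comment> \<open>For a outside T the co-degrees sum to nearly k n, while a set B accounts for at
    most k |B| plus a small error; each vertex of \<open>Z a\<close> falls short by k - 1. Here k
    \<ge> 2 enters through k - 1 \<ge> k / 2.\<close>
  have cZ: "real (card (Z a)) \<le> 3/100 * real n" if a: "a < n" "a \<notin> T" for a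
  proof -
    have xa: "x a \<ge> 99/100" using a by (simp add: T_def)
    have "(\<Sum>b<n. cd a b) = (\<Sum>b\<in>{..<n}-Z a. cd a b) + (\<Sum>b\<in>Z a. cd a b)"
      using sum.subset_diff[OF fZ(2) finite_lessThan] by blast
    moreover have "(\<Sum>b\<in>Z a. cd a b) \<le> (\<Sum>b\<in>Z a. 1)" by (intro sum_mono) (auto simp: Z_def)
    moreover have "card (Z a) \<le> n" using card_mono[OF _ fZ(2)] by simp
    then have "real (card ({..<n} - Z a)) = real n - real (card (Z a))"
      using card_Diff_subset[OF fZ] by simp
    then have "(\<Sum>b\<in>{..<n}-Z a. cd a b) \<le> 6 * (real k * deg a) + real k * (real n - real (card (Z a)))"
      using cd_sum[of "{..<n} - Z a" a] by simp
    moreover have "l\<^sup>2 * x a \<le> (\<Sum>b<n. cd a b)" unfolding walks[OF a(1)]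
      by (intro sum_mono) (simp add: x_le1 mult_left_le)
    moreover have "real k * real n * (99/100) \<le> l\<^sup>2 * x a" using l_sq xa by (intro mult_mono) auto
    moreover have "real k * deg a \<le> real k * D" using no_hub by (intro mult_left_mono) auto
    ultimately have 1: "(real k - 1) * real (card (Z a)) \<le> 6 * (real n / 1000) + real k * real n / 100"
      unfolding kD by (simp add: algebra_simps)
    have "real k / 2 * real (card (Z a)) \<le> (real k - 1) * real (card (Z a))"
      using kpos by (intro mult_right_mono) auto
    also have "\<dots> \<le> real k * (3/1000 * real n) + real k * real n / 100"
      using 1 mult_right_mono[OF kpos, of "3/1000 * real n"] by simp
    finally have "real k * real (card (Z a)) \<le> real k * (26/1000 * real n)" by simp
    then show ?thesis using kpos npos by simp
  qed
  have "has_cycle G (2 * k + 2)"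
  proof (rule greedy_even_cycle[OF graph])
    show "1 \<le> k" using k2 by simp
    show "{v. v < n \<and> v \<notin> T} \<noteq> {}" using w xw by (auto simp: T_def)
  next
    fix U :: "nat set" and a b
    assume U: "finite U" "card U \<le> 2 * k + 2" and a: "a \<in> {v. v < n \<and> v \<notin> T}" and b: "b \<in> {v. v < n \<and> v \<notin> T}"
    \<comment> \<open>Avoiding W makes N(v) disjoint from U. In the absence of hubs W has at most 3
      k D vertices.\<close>
    define W where "W = (\<Union>u\<in>U. N u)"
    have "real (card W) \<le> real (\<Sum>u\<in>U. card (N u))"
      unfolding W_def by (intro of_nat_mono card_UN_le U)
    also have "\<dots> = (\<Sum>u\<in>U. deg u)" by simp
    also have "\<dots> \<le> (\<Sum>u\<in>U. D)" by (intro sum_mono no_hub)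
    also have "\<dots> = real (card U) * D" by simp
    also have "\<dots> \<le> (3 * real k) * D" using U(2) k2 Dpos by (intro mult_right_mono) auto
    also have "\<dots> = 3 * (real k * D)" by simp
    also have "\<dots> = 3 * real n / 1000" unfolding kD by simp
    finally have cW: "real (card W) \<le> 3 * real n / 1000" .
    have "real k \<le> real k ^ 3" using kpos self_le_power[of "real k" 3] by simp
    then have cU: "real (card U) \<le> real n / 1000" using U(2) big kpos by linarith
    have fW: "finite W" unfolding W_def using U finite_nbrs[OF graph] by blast
    have "card (T \<union> U \<union> Z a \<union> Z b \<union> W) \<le> card T + card U + card (Z a) + card (Z b) + card W"
      by (meson add_mono card_Un_le le_trans order_refl)
    moreover have "real (card T) \<le> real n / 1000" using Tsmall Dn npos by linarith
    ultimately have "real (card (T \<union> U \<union> Z a \<union> Z b \<union> W)) < real n"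
      using cU cW cZ[of a] cZ[of b] a b npos by auto
    then have lt: "card (T \<union> U \<union> Z a \<union> Z b \<union> W) < n" by simp
    have fin: "finite (T \<union> U \<union> Z a \<union> Z b \<union> W)"
      by (intro finite_UnI fT(1) U(1) fZ(1) fW)
    have "\<not> {..<n} \<subseteq> T \<union> U \<union> Z a \<union> Z b \<union> W"
      using card_mono[OF fin, of "{..<n}"] lt by auto
    then obtain v where v: "v < n" "v \<notin> T" "v \<notin> U" "v \<notin> Z a" "v \<notin> Z b" "v \<notin> W" by auto
    have "N v \<inter> U = {}"
    proof (rule ccontr)
      assume "N v \<inter> U \<noteq> {}"
      then obtain u where "u \<in> U" "G v u" by (auto simp: nbrs_def)
      then have "v \<in> W" unfolding W_def using graph_onD(4)[OF graph, of v u] by (auto simp: nbrs_def)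
      then show False using v by simp
    qed
    then show "\<exists>v\<in>{v. v < n \<and> v \<notin> T}. v \<notin> U \<and> N v \<inter> U = {} \<and> 2 \<le> codeg G a v \<and> 2 \<le> codeg G b v"
      using v by (intro bexI[of _ v]) (auto simp: Z_def)
  qed
  then show False using free by contradiction
qed

text \<open>Let v have the largest entry in M. Walks from v into M carry weight at most x_v each and
  |M| \<le> n - deg w, so k n x_v \<le> k x_v (n - deg w) up to small terms. As deg w is linear, x_v
  must be small.\<close>

lemma few_large_entries:
  assumes d: "\<delta> > 0" "\<delta> \<le> 1" "deg w \<ge> \<delta> * real n" and a: "\<alpha> > 0" "\<alpha> \<le> 1"
    and P: "P = 7 * real k / (\<alpha> * \<delta> / 72)\<^sup>2 + sqrt (7 * real k * real n) / (\<alpha> * \<delta> / 4)"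
    and small: "P < \<alpha> * \<delta> / 4 * real n"
  shows "real (card {z. z < n \<and> x z \<ge> \<alpha>}) \<le> P"
proof -
  \<comment> \<open>Three walk sums each cost 6 k deg v, and 18 \<delta>' = \<alpha> \<delta> / 4.
    Together with \<alpha>' and P the errors stay below 3/4 \<alpha> \<delta> n.\<close>
  define \<alpha>' where "\<alpha>' = \<alpha> * \<delta> / 4"
  define \<delta>' where "\<delta>' = \<alpha> * \<delta> / 72"
  have ad: "\<alpha> * \<delta> > 0" "\<alpha> * \<delta> \<le> \<alpha>" "\<alpha> * \<delta> \<le> 1"
    using d a by (auto simp: mult_left_le mult_le_one)
  have al: "\<alpha>' > 0" "\<alpha>' \<le> \<alpha>" "\<alpha>' \<le> 1" "\<delta>' > 0" using ad a by (auto simp: \<alpha>'_def \<delta>'_def)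
  define H where "H = {v. v < n \<and> deg v \<ge> \<delta>' * real n}"
  define X where "X = {z\<in>N w. x z \<ge> \<alpha>'}"
  have fin: "finite H" "finite X" "finite (N w)" using finite_nbrs[OF graph] by (auto simp: H_def X_def)
  have l7: "l \<le> sqrt (7 * real k * real n)" using l_sq_le by (rule real_le_rsqrt)
  \<comment> \<open>The entries over N(w) sum to l, which is of order sqrt n only.\<close>
  have "\<alpha>' * real (card X) = (\<Sum>z\<in>X. \<alpha>')" by simp
  also have "\<dots> \<le> (\<Sum>z\<in>X. x z)" by (intro sum_mono) (simp add: X_def)
  also have "\<dots> \<le> (\<Sum>z\<in>N w. x z)" using fin x_nonneg by (intro sum_mono2) (auto simp: X_def)
  also have "\<dots> = l" using eig[OF w] xw by simp
  finally have "real (card X) \<le> sqrt (7 * real k * real n) / \<alpha>'" using al l7 by (simp add: field_simps)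
  moreover have "real (card H) \<le> 7 * real k / \<delta>'\<^sup>2" unfolding H_def using al by (intro card_hubs)
  moreover have "card (H \<union> X) \<le> card H + card X" by (rule card_Un_le)
  ultimately have cP: "real (card (H \<union> X)) \<le> P" unfolding P \<alpha>'_def[symmetric] \<delta>'_def[symmetric] by linarith
  define M where "M = {..<n} - N w - H"
  have fM: "finite M" by (simp add: M_def)
  have Mlt: "x z < \<alpha>" if "z \<in> M" for z
  proof (rule ccontr)
    assume "\<not> x z < \<alpha>"
    have "x ` M \<noteq> {}" "finite (x ` M)" using that fM by auto
    from Max_in[OF this(2,1)] obtain v where v: "v \<in> M" "x v = Max (x ` M)" by auto
    have vmax: "x u \<le> x v" if "u \<in> M" for u unfolding v(2) using that fM by (intro Max_ge) auto
    then have y: "x v \<ge> \<alpha>" using \<open>z \<in> M\<close> \<open>\<not> x z < \<alpha>\<close> by force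
    have vn: "v < n" using v by (simp add: M_def)
    have dv: "deg v \<le> \<delta>' * real n" using v by (auto simp: M_def H_def)
    define P2 where "P2 = N w - X - H"
    have Nn: "N w \<subseteq> {..<n}" by (rule nbrs_subset[OF graph])
    have part: "{..<n} = ((H \<union> X) \<union> P2) \<union> M" using Nn unfolding P2_def M_def H_def X_def by auto
    have "(\<Sum>b<n. cd v b * x b) = (\<Sum>b\<in>((H \<union> X) \<union> P2) \<union> M. cd v b * x b)" using part by simp
    also have "\<dots> = (\<Sum>b\<in>(H \<union> X) \<union> P2. cd v b * x b) + (\<Sum>b\<in>M. cd v b * x b)"
      by (rule sum.union_disjoint) (use fin fM in \<open>auto simp: P2_def M_def X_def\<close>)
    also have "(\<Sum>b\<in>(H \<union> X) \<union> P2. cd v b * x b) = (\<Sum>b\<in>H \<union> X. cd v b * x b) + (\<Sum>b\<in>P2. cd v b * x b)"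
      by (rule sum.union_disjoint) (use fin in \<open>auto simp: P2_def\<close>)
    finally have 0: "l\<^sup>2 * x v = (\<Sum>b\<in>H \<union> X. cd v b * x b) + (\<Sum>b\<in>P2. cd v b * x b) + (\<Sum>b\<in>M. cd v b * x b)"
      using walks[OF vn] by simp
    have kd: "real k * deg v \<le> real k * (\<delta>' * real n)" using dv by (intro mult_left_mono) auto
    have 1: "(\<Sum>b\<in>H \<union> X. cd v b * x b) \<le> 1 * (6 * real k * deg v + real k * real (card (H \<union> X)))"
      by (rule cd_weighted) (use fin x_le1 Nn in \<open>auto simp: H_def X_def\<close>)
    have "(\<Sum>b\<in>P2. cd v b * x b) \<le> \<alpha>' * (6 * real k * deg v + real k * real (card P2))"
      by (rule cd_weighted) (use fin al in \<open>auto simp: P2_def X_def\<close>)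
    also have "\<dots> = \<alpha>' * (6 * (real k * deg v)) + real k * (\<alpha>' * real (card P2))" by (simp add: algebra_simps)
    also have "\<dots> \<le> 1 * (6 * (real k * deg v)) + real k * (\<alpha>' * real n)"
    proof (intro add_mono mult_right_mono mult_left_mono)
      have "card P2 \<le> card {..<n}" by (rule card_mono) (use Nn in \<open>auto simp: P2_def\<close>)
      then show "real (card P2) \<le> real n" by simp
    qed (use al in auto)
    finally have 2: "(\<Sum>b\<in>P2. cd v b * x b) \<le> 6 * (real k * deg v) + real k * (\<alpha>' * real n)" by simp
    have "card (M \<union> N w) \<le> card {..<n}" by (rule card_mono) (use Nn in \<open>auto simp: M_def\<close>)
    moreover have "card (M \<union> N w) = card M + card (N w)"
      by (rule card_Un_disjoint) (use fM fin in \<open>auto simp: M_def\<close>)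
    ultimately have cM: "real (card M) \<le> real n - deg w" by simp
    have "(\<Sum>b\<in>M. cd v b * x b) \<le> x v * (6 * real k * deg v + real k * real (card M))"
      by (rule cd_weighted[OF fM x_nonneg vmax])
    also have "\<dots> = x v * (6 * (real k * deg v)) + real k * (x v * real (card M))" by (simp add: algebra_simps)
    also have "\<dots> \<le> 1 * (6 * (real k * deg v)) + real k * (x v * (real n - deg w))"
      using x_le1[OF vn] x_nonneg cM by (intro add_mono mult_right_mono mult_left_mono) auto
    finally have 3: "(\<Sum>b\<in>M. cd v b * x b) \<le> 6 * (real k * deg v) + real k * (x v * (real n - deg w))" by simp
    have "real k * real n * x v \<le> l\<^sup>2 * x v" using l_sq x_nonneg by (intro mult_right_mono)
    then have "real k * real n * x v \<le> 18 * (real k * deg v) + real k * real (card (H \<union> X))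
        + real k * (\<alpha>' * real n) + real k * (x v * (real n - deg w))"
      using 0 1 2 3 by (simp add: mult.assoc)
    also have "\<dots> \<le> 18 * (real k * (\<delta>' * real n)) + real k * P + real k * (\<alpha>' * real n)
        + real k * (x v * (real n - deg w))"
      using mult_left_mono[OF cP, of "real k"] kd by linarith
    finally have "real k * (x v * deg w) \<le> real k * (18 * \<delta>' * real n + P + \<alpha>' * real n)"
      by (simp add: algebra_simps)
    then have 4: "x v * deg w \<le> 18 * \<delta>' * real n + P + \<alpha>' * real n" using k2 by simp
    have "\<alpha> * (\<delta> * real n) \<le> x v * deg w" using y d a x_nonneg by (intro mult_mono) auto
    moreover have "\<alpha> * \<delta> * real n > 0" using ad n_pos by simp
    ultimately show False using 4 small by (simp add: \<alpha>'_def \<delta>'_def)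
  qed
  have "{z. z < n \<and> x z \<ge> \<alpha>} \<subseteq> H \<union> X"
  proof
    fix z assume z: "z \<in> {z. z < n \<and> x z \<ge> \<alpha>}"
    then have "z \<notin> M" using Mlt by force
    then show "z \<in> H \<union> X" using z al by (auto simp: M_def X_def)
  qed
  then have "card {z. z < n \<and> x z \<ge> \<alpha>} \<le> card (H \<union> X)" using fin by (intro card_mono) auto
  then show ?thesis using cP by linarith
qed

text \<open>The set of large entries is small, so walks into it obey the co-degree bound with k - 1;
  the closed walks at v contribute deg v * x v. Together they give the factor x v + k - 1, at most
  k, so an entry near 1 forces nearly full degree.\<close>

lemma entry_le_degree:
  assumes v: "v < n" and a: "\<alpha> \<ge> 0" and L: "real (card {z. z < n \<and> x z \<ge> \<alpha>}) \<le> \<epsilon> * real n"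
  shows "real k * real n * x v \<le> deg v * (x v + real k - 1) + (5 * real k * \<epsilon> + 7 * real k * \<alpha>) * real n"
proof -
  define L where "L = {z. z < n \<and> x z \<ge> \<alpha>} - {v}"
  define R where "R = {..<n} - L - {v}"
  have fin: "finite L" "finite R" by (auto simp: L_def R_def)
  have "{..<n} = (L \<union> R) \<union> {v}" using v by (auto simp: L_def R_def)
  then have "(\<Sum>b<n. cd v b * x b) = (\<Sum>b\<in>(L \<union> R) \<union> {v}. cd v b * x b)" by simp
  also have "\<dots> = (\<Sum>b\<in>L \<union> R. cd v b * x b) + deg v * x v"
    by (subst sum.union_disjoint) (use fin in \<open>auto simp: L_def R_def codeg_self\<close>)
  also have "(\<Sum>b\<in>L \<union> R. cd v b * x b) = (\<Sum>b\<in>L. cd v b * x b) + (\<Sum>b\<in>R. cd v b * x b)"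
    by (rule sum.union_disjoint) (use fin in \<open>auto simp: R_def\<close>)
  finally have 0: "l\<^sup>2 * x v = (\<Sum>b\<in>L. cd v b * x b) + (\<Sum>b\<in>R. cd v b * x b) + deg v * x v"
    using walks[OF v] by simp
  have cL: "real (card L) \<le> \<epsilon> * real n"
    using L card_mono[of "{z. z < n \<and> x z \<ge> \<alpha>}" L] by (auto simp: L_def)
  have "(\<Sum>b\<in>L. cd v b * x b) \<le> (\<Sum>b\<in>L. cd v b)"
    by (intro sum_mono) (simp add: L_def x_le1 mult_left_le)
  also have "\<dots> \<le> (real k - 1) * deg v + 5 * real k * real (card L)"
    by (rule cd_sum_small) (auto simp: L_def)
  also have "\<dots> \<le> (real k - 1) * deg v + 5 * real k * (\<epsilon> * real n)"
    using mult_left_mono[OF cL, of "5 * real k"] by simp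
  finally have 1: "(\<Sum>b\<in>L. cd v b * x b) \<le> (real k - 1) * deg v + 5 * real k * (\<epsilon> * real n)" .
  have "(\<Sum>b\<in>R. cd v b * x b) \<le> \<alpha> * (6 * real k * deg v + real k * real (card R))"
    by (rule cd_weighted) (use a in \<open>auto simp: R_def L_def\<close>)
  also have "\<dots> \<le> \<alpha> * (6 * real k * real n + real k * real n)"
  proof (intro mult_left_mono add_mono)
    have "card R \<le> card {..<n}" by (rule card_mono) (auto simp: R_def)
    then show "real (card R) \<le> real n" by simp
  qed (use a deg_le in auto)
  finally have 2: "(\<Sum>b\<in>R. cd v b * x b) \<le> 7 * real k * \<alpha> * real n"
    by (simp add: algebra_simps)
  have "real k * real n * x v \<le> l\<^sup>2 * x v" using l_sq x_nonneg by (intro mult_right_mono)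
  then show ?thesis using 0 1 2 by (simp add: algebra_simps)
qed

end

section \<open>The vertices with large entries\<close>

text \<open>The path runs through all of K, alternating with common neighbours, and ends in the
  prescribed r0; F reserves vertices needed later to close a cycle. Each step takes one fresh
  element of R, which the size condition supplies.\<close>

lemma zigzag_path:
  assumes g: "graph_on n G" and K: "finite K" "K \<noteq> {}" and dis: "K \<inter> R = {}"
    and adj: "\<And>h r. h \<in> K \<Longrightarrow> r \<in> R \<Longrightarrow> G h r"
    and r0: "r0 \<in> R" and R: "finite R" "finite F" "card R > 2 * card K + card F + 1"
  shows "\<exists>xs. length xs = 2 * card K \<and> distinct xs \<and> successively G xs \<and> hd xs \<in> K \<and> last xs = r0
    \<and> set xs \<subseteq> K \<union> (R - F) \<union> {r0}"
  using K dis adj R(3)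
proof (induction K rule: finite_ne_induct)
  case (singleton h)
  then show ?case using r0 by (intro exI[of _ "[h, r0]"]) auto
next
  case (insert h K)
  have "\<exists>xs. length xs = 2 * card K \<and> distinct xs \<and> successively G xs \<and> hd xs \<in> K \<and> last xs = r0
    \<and> set xs \<subseteq> K \<union> (R - F) \<union> {r0}"
    by (rule insert.IH) (use insert.prems insert.hyps in auto)
  then obtain xs where xs: "length xs = 2 * card K" "distinct xs" "successively G xs" "hd xs \<in> K"
    "last xs = r0" "set xs \<subseteq> K \<union> (R - F) \<union> {r0}"
    by (elim exE conjE) (rule that)
  have nn: "xs \<noteq> []" using xs(1) insert.hyps by auto
  have "card (set xs \<union> F) \<le> card (set xs) + card F" by (rule card_Un_le)
  also have "card (set xs) = 2 * card K" using xs(1,2) by (simp add: distinct_card)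
  finally have "card (set xs \<union> F) < card R" using insert.prems(3) insert.hyps by simp
  then have "\<not> R \<subseteq> set xs \<union> F" using card_mono[of "set xs \<union> F" R] R by auto
  then obtain r where r: "r \<in> R" "r \<notin> set xs" "r \<notin> F" by auto
  have "G (hd xs) r" using insert.prems(2) r xs(4) by auto
  then have "G r (hd xs)" by (rule graph_onD(4)[OF g])
  moreover have "G h r" using insert.prems(2) r by auto
  moreover have "h \<notin> set xs" using xs(6) insert.hyps insert.prems(1) r0 by auto
  moreover have "h \<noteq> r" using insert.prems(1) r by auto
  ultimately have "distinct (h # r # xs)" "successively G (h # r # xs)"
    using xs r nn by (auto simp: successively_Cons)
  moreover have "set (h # r # xs) \<subseteq> insert h K \<union> (R - F) \<union> {r0}" using xs(6) r by auto
  moreover have "length (h # r # xs) = 2 * card (insert h K)" using xs(1) insert.hyps by simp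
  moreover have "last (h # r # xs) = r0" using xs(5) nn by simp
  ultimately show ?case by (intro exI[of _ "h # r # xs"]) simp
qed

context extremal
begin

lemma common_nbrs_card:
  assumes K: "finite K" and d: "\<And>h. h \<in> K \<Longrightarrow> deg h \<ge> (1 - c) * real n"
  shows "real (card ({..<n} - (\<Union>h\<in>K. {..<n} - N h))) \<ge> (1 - real (card K) * c) * real n"
proof -
  let ?U = "\<Union>h\<in>K. {..<n} - N h"
  have "real (card ?U) \<le> real (\<Sum>h\<in>K. card ({..<n} - N h))" by (intro of_nat_mono card_UN_le K)
  also have "\<dots> = (\<Sum>h\<in>K. real (card ({..<n} - N h)))" by simp
  also have "\<dots> \<le> (\<Sum>h\<in>K. c * real n)"
  proof (rule sum_mono)
    fix h assume "h \<in> K"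
    have "card ({..<n} - N h) = n - card (N h)"
      using card_Diff_subset[OF finite_nbrs[OF graph] nbrs_subset[OF graph], of h] by simp
    then show "real (card ({..<n} - N h)) \<le> c * real n"
      using d[OF \<open>h \<in> K\<close>] card_nbrs_le[OF graph, of h] by (simp add: algebra_simps of_nat_diff)
  qed
  finally have U: "real (card ?U) \<le> real (card K) * c * real n" by simp
  have sub: "?U \<subseteq> {..<n}" by blast
  have "card ?U \<le> n" using card_mono[OF _ sub] by simp
  then have "real (card ({..<n} - ?U)) = real n - real (card ?U)"
    using card_Diff_subset[OF finite_subset[OF sub finite_lessThan] sub] by (simp add: of_nat_diff)
  then show ?thesis using U by (simp add: algebra_simps)
qed

text \<open>Any k + 1 such vertices have at least n / 2 common neighbours, and a zigzag through them
  closes to C_{2k+2}.\<close>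

lemma card_high_degree_le:
  assumes K: "K \<subseteq> {..<n}" and d: "\<And>h. h \<in> K \<Longrightarrow> deg h \<ge> (1 - c) * real n"
    and c: "c \<ge> 0" "(real k + 1) * c \<le> 1 / 2" and big: "real n \<ge> 100 * real k"
  shows "card K \<le> k"
proof (rule ccontr)
  assume "\<not> card K \<le> k"
  then have "k + 1 \<le> card K" by simp
  then obtain K' where K': "K' \<subseteq> K" "card K' = k + 1"
    by (rule obtain_subset_with_card_n)
  have fK: "finite K'" by (rule finite_subset[OF subset_trans[OF K'(1) K]]) simp
  define R where "R = {..<n} - (\<Union>h\<in>K'. {..<n} - N h)"
  have "(1 - 1/2) * real n \<le> (1 - real (card K') * c) * real n"
    using c K' by (intro mult_right_mono) (auto simp: add.commute)
  also have "\<dots> \<le> real (card R)"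
    unfolding R_def by (rule common_nbrs_card[OF fK]) (use d K' in auto)
  finally have cR: "real (card R) \<ge> real n / 2" by simp
  have kk: "real k \<ge> 2" using k2 by simp
  have "real (card R) > real (2 * card K' + card ({}::nat set) + 1)"
    using cR big K' kk by simp
  then have cR': "card R > 2 * card K' + card ({}::nat set) + 1" by linarith
  have "R \<noteq> {}" using cR' by auto
  then obtain r0 where r0: "r0 \<in> R" by blast
  have adj: "G h r" if "h \<in> K'" "r \<in> R" for h r using that by (auto simp: R_def nbrs_def)
  have dis: "K' \<inter> R = {}"
  proof (rule ccontr)
    assume "K' \<inter> R \<noteq> {}"
    then obtain h where "h \<in> K'" "h \<in> R" by blast
    then show False using adj[of h h] graph_onD(3)[OF graph, of h h] by simp
  qed
  have "K' \<noteq> {}" using K' by auto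
  from zigzag_path[OF graph fK this dis adj r0 _ _ cR'] obtain xs where xs:
    "length xs = 2 * card K'" "distinct xs" "successively G xs" "hd xs \<in> K'" "last xs = r0"
    by (auto simp: R_def)
  have "G (last xs) (hd xs)" unfolding xs(5) by (rule graph_onD(4)[OF graph adj[OF xs(4) r0]])
  then have "has_cycle G (2 * k + 2)" using xs K' by (intro has_cycleI[of xs]) auto
  then show False using free by contradiction
qed

text \<open>The co-degrees at w over the other large entries sum to at most about (k-1) n. With
  fewer than k entries near 1, those apart from w take at most (k-2) n of this; the remaining n is
  weighted by at most 1 - \<eta>, a loss of about \<eta> n, while the errors amount to \<eta> n /
  4.\<close>

lemma card_large_entries_ge:
  assumes eta: "\<eta> > 0" "\<eta> < 1" and a: "\<alpha> \<ge> 0" "\<alpha> \<le> 1 - \<eta>"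
    and L: "real (card {z. z < n \<and> x z \<ge> \<alpha>}) \<le> \<epsilon> * real n"
    and e: "5 * real k * \<epsilon> + 7 * real k * \<alpha> \<le> \<eta> / 4" and eps: "\<epsilon> \<ge> 0"
  shows "card {v. v < n \<and> x v \<ge> 1 - \<eta>} \<ge> k"
proof (rule ccontr)
  let ?K = "{v. v < n \<and> x v \<ge> 1 - \<eta>}"
  assume "\<not> ?thesis"
  then have few: "card ?K \<le> k - 1" by simp
  \<comment> \<open>w is set apart since its own term is deg w and \<open>cd_sum_small\<close> needs
    a set avoiding w.\<close>
  define K where "K = ?K - {w}"
  define L1 where "L1 = {z. z < n \<and> x z \<ge> \<alpha>} - ?K"
  define R where "R = {..<n} - {z. z < n \<and> x z \<ge> \<alpha>}"
  have wK: "w \<in> ?K" using w xw eta by simp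
  have fin: "finite K" "finite L1" "finite R" by (auto simp: K_def L1_def R_def)
  have "w \<notin> K" by (simp add: K_def)
  have "{..<n} = (insert w K \<union> L1) \<union> R" using w xw a eta by (auto simp: K_def L1_def R_def)
  then have "(\<Sum>b<n. cd w b * x b) = (\<Sum>b\<in>(insert w K \<union> L1) \<union> R. cd w b * x b)" by simp
  also have "\<dots> = (\<Sum>b\<in>insert w K \<union> L1. cd w b * x b) + (\<Sum>b\<in>R. cd w b * x b)"
    by (rule sum.union_disjoint) (use fin wK a in \<open>auto simp: K_def L1_def R_def\<close>)
  also have "(\<Sum>b\<in>insert w K \<union> L1. cd w b * x b) = (\<Sum>b\<in>insert w K. cd w b * x b) + (\<Sum>b\<in>L1. cd w b * x b)"
    by (rule sum.union_disjoint) (use fin wK in \<open>auto simp: K_def L1_def\<close>)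
  also have "(\<Sum>b\<in>insert w K. cd w b * x b) = deg w + (\<Sum>b\<in>K. cd w b * x b)"
    using fin xw \<open>w \<notin> K\<close> by (simp add: codeg_self)
  finally have 0: "l\<^sup>2 = deg w + (\<Sum>b\<in>K. cd w b * x b) + (\<Sum>b\<in>L1. cd w b * x b) + (\<Sum>b\<in>R. cd w b * x b)"
    using walks[OF w] xw by simp
  define S1 where "S1 = (\<Sum>b\<in>K. cd w b)"
  define S2 where "S2 = (\<Sum>b\<in>L1. cd w b)"
  have 1: "(\<Sum>b\<in>K. cd w b * x b) \<le> S1" unfolding S1_def
    by (intro sum_mono) (auto simp: K_def x_le1 mult_left_le)
  have 2: "(\<Sum>b\<in>L1. cd w b * x b) \<le> (1 - \<eta>) * S2" unfolding S2_def sum_distrib_left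
  proof (rule sum_mono)
    fix b assume "b \<in> L1"
    then have "x b \<le> 1 - \<eta>" by (auto simp: L1_def)
    from mult_left_mono[OF this, of "cd w b"] show "cd w b * x b \<le> (1 - \<eta>) * cd w b"
      by (simp add: mult.commute)
  qed
  have "(\<Sum>b\<in>R. cd w b * x b) \<le> \<alpha> * (6 * real k * deg w + real k * real (card R))"
    by (rule cd_weighted) (use a in \<open>auto simp: R_def\<close>)
  also have "\<dots> \<le> \<alpha> * (6 * real k * real n + real k * real n)"
  proof (intro mult_left_mono add_mono)
    have "card R \<le> card {..<n}" by (rule card_mono) (auto simp: R_def)
    then show "real (card R) \<le> real n" by simp
  qed (use a deg_le in auto)
  finally have 3: "(\<Sum>b\<in>R. cd w b * x b) \<le> 7 * real k * \<alpha> * real n" by (simp add: algebra_simps)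
  have "S1 + S2 = (\<Sum>b\<in>K \<union> L1. cd w b)" unfolding S1_def S2_def
    by (rule sum.union_disjoint[symmetric]) (use fin in \<open>auto simp: K_def L1_def\<close>)
  also have "\<dots> \<le> (real k - 1) * deg w + 5 * real k * real (card (K \<union> L1))"
    by (rule cd_sum_small) (use fin wK in \<open>auto simp: K_def L1_def\<close>)
  also have "\<dots> \<le> (real k - 1) * real n + 5 * real k * (\<epsilon> * real n)"
  proof (intro add_mono mult_left_mono)
    have "card (K \<union> L1) \<le> card {z. z < n \<and> x z \<ge> \<alpha>}"
      by (rule card_mono) (use a in \<open>auto simp: K_def L1_def\<close>)
    then show "real (card (K \<union> L1)) \<le> \<epsilon> * real n" using L by simp
  qed (use k2 deg_le in auto)
  finally have 4: "S1 + S2 \<le> (real k - 1) * real n + 5 * real k * \<epsilon> * real n" by simp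
  have "S1 \<le> (\<Sum>b\<in>K. real n)" unfolding S1_def
  proof (rule sum_mono)
    fix b
    have "codeg G w b \<le> card (N w)" unfolding codeg_def
      by (intro card_mono finite_nbrs[OF graph]) simp
    then show "cd w b \<le> real n" using deg_le[of w] by linarith
  qed
  also have "\<dots> = real (card K) * real n" by simp
  also have "\<dots> \<le> (real k - 2) * real n"
  proof (rule mult_right_mono)
    have "card K = card ?K - 1" using wK by (simp add: K_def)
    then show "real (card K) \<le> real k - 2" using few k2 by simp
  qed simp
  finally have 5: "S1 \<le> (real k - 2) * real n" .
  define E where "E = 5 * real k * \<epsilon> * real n"
  define E' where "E' = 7 * real k * \<alpha> * real n"
  have EE: "E \<ge> 0" "E' \<ge> 0" using eps a by (simp_all add: E_def E'_def)
  have E4: "E + E' \<le> \<eta> / 4 * real n"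
    using mult_right_mono[OF e, of "real n"] by (simp add: E_def E'_def algebra_simps)
  have "real k * real n \<le> real n + S1 + (1 - \<eta>) * S2 + E'"
    using 0 1 2 3 l_sq deg_le[of w] unfolding E'_def by linarith
  also have "(1 - \<eta>) * S2 \<le> (1 - \<eta>) * ((real k - 1) * real n + E - S1)"
    using 4 eta unfolding E_def by (intro mult_left_mono) auto
  finally have "real k * real n \<le> real n + S1 + (1 - \<eta>) * ((real k - 1) * real n + E - S1) + E'" by simp
  then have "\<eta> * ((real k - 1) * real n - S1) \<le> E - \<eta> * E + E'" by (simp add: algebra_simps)
  also have "\<dots> \<le> E + E'" using EE eta by simp
  also have "\<dots> \<le> \<eta> * (real n / 4)" using E4 by simp
  finally have "(real k - 1) * real n - S1 \<le> real n / 4" using eta by simp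
  then have "real n \<le> real n / 4" using 5 by (simp add: algebra_simps)
  then show False using n_pos by simp
qed

end

section \<open>Structure around k nearly dominating vertices\<close>

locale extremal_core = extremal +
  fixes K :: "nat set" and \<eta> :: real
  assumes no_odd: "\<not> has_cycle G (2 * k + 1)"
    and K_sub: "K \<subseteq> {..<n}" and K_card: "card K = k"
    and eta: "\<eta> = 1 / (2000 * real k ^ 3)"
    and K_deg: "\<And>h. h \<in> K \<Longrightarrow> deg h \<ge> (1 - 2 * \<eta>) * real n"
    and K_x: "\<And>h. h \<in> K \<Longrightarrow> x h \<ge> 1 - \<eta>"
    and degree_bound: "\<And>v. v < n \<Longrightarrow> real k * real n * x v \<le> deg v * (x v + real k - 1) + \<eta> / 4 * real n"
    and big: "real n \<ge> 10000 * real k ^ 3"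
begin

definition R :: "nat set" where "R = {v. v < n \<and> v \<notin> K \<and> (\<forall>h\<in>K. G h v)}"
definition Q :: "nat set" where "Q = {..<n} - K - R"

lemma finite_KRQ: "finite K" "finite R" "finite Q"
  using K_sub finite_subset by (auto simp: R_def Q_def)

lemma k_real: "real k \<ge> 2"
  using k2 by simp

lemma eta_pos: "\<eta> > 0"
  using k_real by (simp add: eta)

lemma k_cube_eta: "real k ^ 3 * \<eta> = 1 / 2000"
  using k_real by (simp add: eta)

lemma k_eta: "real k * \<eta> \<le> 1 / 8000" "real k * (real k * \<eta>) \<le> 1 / 4000" "\<eta> \<le> 1 / 16000"
proof -
  have 1: "real k * (real k * (real k * \<eta>)) = 1 / 2000" using k_cube_eta by (simp add: power3_eq_cube mult.assoc)
  have 2: "2 * (real k * (real k * \<eta>)) \<le> real k * (real k * (real k * \<eta>))"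
    using k_real eta_pos by (intro mult_right_mono) auto
  then show "real k * (real k * \<eta>) \<le> 1 / 4000" using 1 by linarith
  have 3: "2 * (real k * \<eta>) \<le> real k * (real k * \<eta>)" using k_real eta_pos by (intro mult_right_mono) auto
  then show "real k * \<eta> \<le> 1 / 8000" using 1 2 by linarith
  have "2 * \<eta> \<le> real k * \<eta>" using k_real eta_pos by (intro mult_right_mono) auto
  then show "\<eta> \<le> 1 / 16000" using 1 2 3 by linarith
qed

lemma n_eta: "\<eta> * real n \<ge> 5"
proof -
  have "\<eta> * (10000 * real k ^ 3) \<le> \<eta> * real n" using big eta_pos by (intro mult_left_mono) auto
  then show ?thesis using k_cube_eta by (simp add: mult.commute)
qed

lemma card_Q: "real (card Q) \<le> 2 * real k * \<eta> * real n"
proof -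
  let ?C = "{..<n} - (\<Union>h\<in>K. {..<n} - N h)"
  have "real (card ?C) \<ge> (1 - real (card K) * (2 * \<eta>)) * real n"
    by (rule common_nbrs_card[OF finite_KRQ(1) K_deg])
  then have c: "real (card ?C) \<ge> (1 - real k * (2 * \<eta>)) * real n" unfolding K_card .
  have "Q \<inter> ?C = {}" using finite_KRQ by (auto simp: Q_def R_def nbrs_def)
  then have "card (Q \<union> ?C) = card Q + card ?C" using finite_KRQ by (intro card_Un_disjoint) auto
  moreover have "card (Q \<union> ?C) \<le> card {..<n}" by (rule card_mono) (auto simp: Q_def)
  ultimately have "real (card Q) + real (card ?C) \<le> real n" by simp
  then show ?thesis using c by (simp add: algebra_simps)
qed

text \<open>The shape required by \<open>zigzag_path\<close> when a single vertex is
  reserved.\<close>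

lemma card_R: "card R > 2 * card K + card {r::nat} + 1"
proof -
  have "{..<n} = (K \<union> R) \<union> Q" using K_sub by (auto simp: Q_def R_def)
  then have "n \<le> card (K \<union> R) + card Q" using card_Un_le[of "K \<union> R" Q] by (metis card_lessThan)
  then have "n \<le> card K + card R + card Q" using card_Un_le[of K R] by linarith
  then have "real n \<le> real (card K + card R + card Q)" by (rule of_nat_mono)
  then have "real n \<le> real k + real (card R) + 2 * ((real k * \<eta>) * real n)" using card_Q K_card by simp
  moreover have "(real k * \<eta>) * real n \<le> 1 / 8000 * real n" using k_eta by (intro mult_right_mono) auto
  moreover have "real k \<le> real k ^ 3" using k_real self_le_power[of "real k" 3] by simp
  ultimately have "real (card R) > 2 * real k + 2" using big k_real by linarith
  then have "real (card R) > real (2 * card K + card {r} + 1)" using K_card by simp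
  then show ?thesis by linarith
qed

lemma R_adj: "h \<in> K \<Longrightarrow> r \<in> R \<Longrightarrow> G h r"
  by (simp add: R_def)

lemma zigzag:
  assumes "r0 \<in> R"
  shows "\<exists>xs. length xs = 2 * k \<and> distinct xs \<and> successively G xs \<and> hd xs \<in> K \<and> last xs = r0
    \<and> set xs \<subseteq> K \<union> (R - {r}) \<union> {r0}"
proof -
  have "K \<noteq> {}" using K_card k2 by auto
  moreover have "K \<inter> R = {}" by (auto simp: R_def)
  ultimately show ?thesis
    using zigzag_path[OF graph finite_KRQ(1) _ _ R_adj assms finite_KRQ(2) _ card_R] K_card by simp
qed

text \<open>An edge inside R closes a zigzag on 2k vertices to C_{2k+1}; here the odd cycle is
  used.\<close>

lemma R_independent:
  assumes r: "r \<in> R" "r' \<in> R"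
  shows "\<not> G r r'"
proof
  assume e: "G r r'"
  obtain xs where xs: "length xs = 2 * k" "distinct xs" "successively G xs" "hd xs \<in> K" "last xs = r"
    "set xs \<subseteq> K \<union> (R - {r'}) \<union> {r}" using zigzag[OF r(1), of r'] by (elim exE conjE) (rule that)
  have nn: "xs \<noteq> []" using xs(1) k2 by auto
  have "r' \<notin> set xs" using xs(6) r graph_onD(3)[OF graph e] by (auto simp: R_def)
  moreover have "G r' (hd xs)" by (rule graph_onD(4)[OF graph R_adj[OF xs(4) r(2)]])
  ultimately have "has_cycle G (2 * k + 1)"
    using xs e nn by (intro has_cycleI[of "xs @ [r']"]) (auto simp: successively_append_iff)
  then show False using no_odd by contradiction
qed

text \<open>With two neighbours r and r' of q, the zigzag ending in r extends by q and r' and closes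
  to C_{2k+2}.\<close>

lemma Q_one_R_nbr:
  assumes q: "q \<in> Q" and r: "r \<in> R" "r' \<in> R" "G q r" "G q r'"
  shows "r = r'"
proof (rule ccontr)
  assume ne: "r \<noteq> r'"
  obtain xs where xs: "length xs = 2 * k" "distinct xs" "successively G xs" "hd xs \<in> K" "last xs = r"
    "set xs \<subseteq> K \<union> (R - {r'}) \<union> {r}" using zigzag[OF r(1), of r'] by (elim exE conjE) (rule that)
  have nn: "xs \<noteq> []" using xs(1) k2 by auto
  have "r' \<notin> set xs" using xs(6) r ne by (auto simp: R_def)
  moreover have "q \<notin> set xs" using xs(6) q r by (auto simp: Q_def)
  moreover have "q \<noteq> r'" using q r by (auto simp: Q_def)
  moreover have "G r' (hd xs)" by (rule graph_onD(4)[OF graph R_adj[OF xs(4) r(2)]])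
  moreover have "G r q" by (rule graph_onD(4)[OF graph r(3)])
  ultimately have "has_cycle G (2 * k + 2)"
    using xs r nn by (intro has_cycleI[of "xs @ [q, r']"]) (auto simp: successively_append_iff)
  then show False using free by contradiction
qed

lemma card_R_nbrs:
  assumes "v < n" "v \<notin> K"
  shows "card (N v \<inter> R) \<le> 1"
proof (cases "v \<in> R")
  case True
  then have "N v \<inter> R = {}" using R_independent by (auto simp: nbrs_def)
  then show ?thesis by simp
next
  case False
  then have "v \<in> Q" using assms by (simp add: Q_def)
  then have "a = b" if "a \<in> N v \<inter> R" "b \<in> N v \<inter> R" for a b
    using Q_one_R_nbr[of v a b] that by (auto simp: nbrs_def)
  then show ?thesis by (simp add: card_le_Suc0_iff_eq finite_KRQ)
qed

lemma nbrs_split: "N v = (N v \<inter> K) \<union> (N v \<inter> R) \<union> (N v \<inter> Q)"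
  using nbrs_subset[OF graph, of v] by (auto simp: Q_def)

text \<open>Outside K a vertex has at most k neighbours in K, one in R and |Q| in Q. Its degree is
  therefore of order k \<eta> n, and \<open>degree_bound\<close> turns this into a small
  entry.\<close>

lemma x_small:
  assumes v: "v < n" "v \<notin> K"
  shows "x v \<le> 4 * real k * \<eta>"
proof -
  have "card (N v) = card ((N v \<inter> K) \<union> (N v \<inter> R) \<union> (N v \<inter> Q))"
    by (rule arg_cong[OF nbrs_split])
  moreover have "\<dots> \<le> card ((N v \<inter> K) \<union> (N v \<inter> R)) + card (N v \<inter> Q)" by (rule card_Un_le)
  moreover have "card ((N v \<inter> K) \<union> (N v \<inter> R)) \<le> card (N v \<inter> K) + card (N v \<inter> R)" by (rule card_Un_le)
  moreover have "card (N v \<inter> K) \<le> k" using K_card card_mono[OF finite_KRQ(1), of "N v \<inter> K"] by simp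
  moreover have "card (N v \<inter> Q) \<le> card Q" by (rule card_mono[OF finite_KRQ(3)]) simp
  moreover have "card (N v \<inter> R) \<le> 1" by (rule card_R_nbrs[OF v])
  ultimately have "card (N v) \<le> k + 1 + card Q" by linarith
  then have "deg v \<le> real (k + 1 + card Q)" by (rule of_nat_mono)
  then have d: "deg v \<le> 2 * real k + 2 * (real k * (\<eta> * real n))" using card_Q k_real unfolding mult.assoc by simp
  have "real k * 5 \<le> real k * (\<eta> * real n)" using n_eta by (intro mult_left_mono) auto
  then have d: "deg v \<le> 3 * (real k * (\<eta> * real n))" using d k_real by linarith
  have "deg v * (x v + real k - 1) \<le> deg v * real k" using x_le1[OF v(1)] by (intro mult_left_mono) auto
  also have "\<dots> \<le> 3 * (real k * (\<eta> * real n)) * real k" using d by (rule mult_right_mono) simp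
  finally have "real k * real n * x v \<le> 3 * (real k * (\<eta> * real n)) * real k + \<eta> / 4 * real n"
    using degree_bound[OF v(1)] by linarith
  also have "\<eta> / 4 * real n \<le> real k * (\<eta> * real n) * real k"
  proof -
    have "1 \<le> real k * real k" using k_real mult_mono[of 1 "real k" 1 "real k"] by simp
    then have "1 * (\<eta> * real n) \<le> (real k * real k) * (\<eta> * real n)" using eta_pos by (intro mult_right_mono) auto
    moreover have "0 \<le> \<eta> * real n" using eta_pos by simp
    ultimately show ?thesis by (simp add: mult_ac)
  qed
  finally have "(real k * real n) * x v \<le> (real k * real n) * (4 * real k * \<eta>)" by (simp add: mult_ac)
  then show ?thesis using k_real n_pos by simp
qed

end

section \<open>Comparison with the join\<close>

text \<open>S_{n,k} with its clique on an arbitrary set K, for comparison with G on the same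
  vertices.\<close>

definition join_graph :: "nat \<Rightarrow> nat set \<Rightarrow> nat \<Rightarrow> nat \<Rightarrow> bool" where
  "join_graph n K i j \<longleftrightarrow> i < n \<and> j < n \<and> i \<noteq> j \<and> (i \<in> K \<or> j \<in> K)"

lemma graph_on_join_graph: "graph_on n (join_graph n K)"
  by (auto simp: graph_on_def join_graph_def)

lemma S_graph_eq_join: "S_graph n k = join_graph n {..<k}"
  by (intro ext) (simp add: S_graph_def join_graph_def)

context extremal_core
begin

abbreviation J :: "nat \<Rightarrow> nat \<Rightarrow> bool" where "J \<equiv> join_graph n K"

lemma nbrs_J_outside: "v < n \<Longrightarrow> v \<notin> K \<Longrightarrow> nbrs J v = K"
  using K_sub by (auto simp: nbrs_def join_graph_def)

lemma nbrs_J_inside: "h \<in> K \<Longrightarrow> N h \<subseteq> nbrs J h"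
  using K_sub graph_onD(2,3)[OF graph, of h] by (auto simp: nbrs_def join_graph_def)

definition X :: real where "X = (\<Sum>q\<in>Q. x q)"
text \<open>The edges inside Q weighted by x, each counted in both directions.\<close>

definition E :: real where "E = (\<Sum>q\<in>Q. x q * (\<Sum>j\<in>N q \<inter> Q. x j))"

lemma X_nonneg: "X \<ge> 0"
  unfolding X_def by (intro sum_nonneg x_nonneg)

lemma Q_D: "q \<in> Q \<Longrightarrow> q < n \<and> q \<notin> K"
  by (simp add: Q_def)

lemma sum_nbrs_split:
  "(\<Sum>j\<in>N v. x j) = (\<Sum>j\<in>N v \<inter> K. x j) + (\<Sum>j\<in>N v \<inter> R. x j) + (\<Sum>j\<in>N v \<inter> Q. x j)"
proof -
  have "(\<Sum>j\<in>N v. x j) = (\<Sum>j\<in>(N v \<inter> K) \<union> (N v \<inter> R) \<union> (N v \<inter> Q). x j)"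
    by (rule arg_cong[OF nbrs_split])
  also have "\<dots> = (\<Sum>j\<in>(N v \<inter> K) \<union> (N v \<inter> R). x j) + (\<Sum>j\<in>N v \<inter> Q. x j)"
    by (rule sum.union_disjoint) (use finite_KRQ in \<open>auto simp: Q_def\<close>)
  also have "(\<Sum>j\<in>(N v \<inter> K) \<union> (N v \<inter> R). x j) = (\<Sum>j\<in>N v \<inter> K. x j) + (\<Sum>j\<in>N v \<inter> R. x j)"
    by (rule sum.union_disjoint) (use finite_KRQ in \<open>auto simp: R_def\<close>)
  finally show ?thesis .
qed

lemma sum_R_nbrs_le:
  assumes "v < n" "v \<notin> K"
  shows "(\<Sum>j\<in>N v \<inter> R. x j) \<le> 4 * real k * \<eta>"
proof -
  have "(\<Sum>j\<in>N v \<inter> R. x j) \<le> (\<Sum>j\<in>N v \<inter> R. 4 * real k * \<eta>)"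
    by (intro sum_mono x_small) (auto simp: R_def)
  also have "\<dots> = real (card (N v \<inter> R)) * (4 * real k * \<eta>)" by simp
  also have "\<dots> \<le> 1 * (4 * real k * \<eta>)"
    using card_R_nbrs[OF assms] eta_pos by (intro mult_right_mono) auto
  finally show ?thesis by simp
qed

text \<open>E is the quadratic form of the graph H induced on Q, hence at most the spectral radius
  of H times the squared weight Y of Q. Since Q is small, that radius is at most l / (8 k), so k E
  \<le> l Y / 8.\<close>

lemma Q_edges_le: "E \<le> X / 4"
proof -
  define H where "H u v \<longleftrightarrow> G u v \<and> u \<in> Q \<and> v \<in> Q" for u v
  have H: "graph_on n H" unfolding graph_on_def
  proof (intro allI impI)
    fix i j assume e: "H i j"
    then have "G i j" by (simp add: H_def)
    from graph_onD[OF graph this] e show "i < n \<and> j < n \<and> i \<noteq> j \<and> H j i" by (simp add: H_def)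
  qed
  define y where "y i = (if i \<in> Q then x i else 0)" for i
  define Y where "Y = (\<Sum>q\<in>Q. (x q)\<^sup>2)"
  have Qn: "Q \<subseteq> {..<n}" by (auto simp: Q_def)
  have nH: "nbrs H q = N q \<inter> Q" if "q \<in> Q" for q using that by (auto simp: nbrs_def H_def)
  have "qform n H y = (\<Sum>i\<in>Q. y i * (\<Sum>j\<in>nbrs H i. y j))"
    unfolding qform_rows by (rule sum.mono_neutral_right) (use Qn in \<open>auto simp: y_def\<close>)
  also have "\<dots> = E" unfolding E_def
    by (rule sum.cong[OF refl]) (auto simp: y_def nH intro!: sum.cong)
  finally have q: "qform n H y = E" .
  have yY: "(\<Sum>i<n. (y i)\<^sup>2) = Y"
  proof -
    have "(\<Sum>i<n. (y i)\<^sup>2) = (\<Sum>i\<in>Q. (y i)\<^sup>2)"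
      by (rule sum.mono_neutral_right) (use Qn in \<open>auto simp: y_def\<close>)
    also have "\<dots> = Y" unfolding Y_def by (rule sum.cong) (auto simp: y_def)
    finally show ?thesis .
  qed
  have Y0: "Y \<ge> 0" unfolding Y_def by (intro sum_nonneg) simp
  have "\<not> has_cycle H (2 * k + 2)"
    using has_cycle_mono[of H "2 * k + 2" G] free by (auto simp: H_def)
  then have "(graph_spectral_radius n H)\<^sup>2 \<le> 7 * real k * real (card Q)"
    using k2 by (intro spectral_radius_sq_le[OF H n_pos _ _ Qn]) (auto simp: H_def)
  also have "\<dots> \<le> 7 * real k * (2 * real k * \<eta> * real n)" using card_Q by (intro mult_left_mono) auto
  finally have lH: "(graph_spectral_radius n H)\<^sup>2 \<le> 14 * (real k * (real k * \<eta>)) * real n" by (simp add: mult_ac)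
  \<comment> \<open>Here the order of \<eta> is decided: k^2 * 14 k^2 \<eta> n \<le> k n / 64
    amounts to 896 k^3 \<eta> \<le> 1.\<close>
  have "real k * (real k * (14 * (real k * (real k * \<eta>)) * real n)) = real k * (14 * (real k ^ 3 * \<eta>) * real n)"
    by (simp add: power3_eq_cube)
  also have "\<dots> = real k * (14 * (1 / 2000) * real n)" by (simp only: k_cube_eta)
  also have "\<dots> \<le> real k * (real n / 64)" by (intro mult_left_mono) auto
  also have "\<dots> \<le> l\<^sup>2 / 64" using l_sq by simp
  finally have "(real k)\<^sup>2 * (14 * (real k * (real k * \<eta>)) * real n) \<le> l\<^sup>2 / 64" by (simp add: power2_eq_square)
  moreover have "(real k)\<^sup>2 * (graph_spectral_radius n H)\<^sup>2 \<le> (real k)\<^sup>2 * (14 * (real k * (real k * \<eta>)) * real n)"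
    using lH by (intro mult_left_mono) auto
  ultimately have "(real k * graph_spectral_radius n H)\<^sup>2 \<le> (l / 8)\<^sup>2" by (simp add: power_mult_distrib power_divide)
  then have lk: "real k * graph_spectral_radius n H \<le> l / 8"
    using l_nonneg by (rule power2_le_imp_le[OF _ divide_nonneg_pos]) simp
  have "real k * E \<le> real k * (graph_spectral_radius n H * Y)"
    using rayleigh_bound[OF H n_pos, of y] unfolding q yY by (intro mult_left_mono) auto
  also have "\<dots> \<le> l / 8 * Y" using mult_right_mono[OF lk Y0] by (simp add: mult.assoc)
  finally have kE: "real k * E \<le> l * Y / 8" by simp
  \<comment> \<open>The eigenvalue equation over Q gives l Y \<le> (k+1) X + E. As E \<le> l Y / 16,
    the term E can be absorbed, which leaves l Y of order k X.\<close>
  have "l * Y = (\<Sum>q\<in>Q. x q * (\<Sum>j\<in>N q. x j))" unfolding Y_def sum_distrib_left[of l]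
  proof (rule sum.cong[OF refl])
    fix q assume "q \<in> Q"
    then have "(\<Sum>j\<in>N q. x j) = l * x q" using Qn by (intro eig) auto
    then show "l * (x q)\<^sup>2 = x q * (\<Sum>j\<in>N q. x j)" by (simp only: power2_eq_square mult_ac)
  qed
  also have "\<dots> \<le> (\<Sum>q\<in>Q. x q * (real k + 1) + x q * (\<Sum>j\<in>N q \<inter> Q. x j))"
  proof (rule sum_mono)
    fix q assume "q \<in> Q"
    note qn = Q_D[OF this]
    have "(\<Sum>j\<in>N q \<inter> K. x j) \<le> (\<Sum>j\<in>N q \<inter> K. 1)" using K_sub by (intro sum_mono x_le1) auto
    also have "\<dots> = real (card (N q \<inter> K))" by simp
    also have "\<dots> \<le> real k" using K_card card_mono[OF finite_KRQ(1), of "N q \<inter> K"] by simp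
    finally have "(\<Sum>j\<in>N q \<inter> K. x j) \<le> real k" .
    moreover have "(\<Sum>j\<in>N q \<inter> R. x j) \<le> 1" using sum_R_nbrs_le[of q] qn k_eta by auto
    ultimately have "(\<Sum>j\<in>N q. x j) \<le> (real k + 1) + (\<Sum>j\<in>N q \<inter> Q. x j)"
      unfolding sum_nbrs_split[of q] by simp
    from mult_left_mono[OF this x_nonneg[of q]]
    show "x q * (\<Sum>j\<in>N q. x j) \<le> x q * (real k + 1) + x q * (\<Sum>j\<in>N q \<inter> Q. x j)"
      by (simp only: distrib_left)
  qed
  also have "\<dots> = X * (real k + 1) + E" by (simp only: sum.distrib X_def E_def sum_distrib_right)
  finally have lY: "l * Y \<le> X * (real k + 1) + E" .
  have E0: "E \<ge> 0" unfolding E_def using x_nonneg by (intro sum_nonneg mult_nonneg_nonneg) auto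
  have "2 * E \<le> real k * E" using k_real E0 by (intro mult_right_mono) auto
  then have "E \<le> l * Y / 16" using kE by simp
  then have "l * Y * (15 / 16) \<le> X * (real k + 1)" using lY by simp
  moreover have "X * (real k + 1) \<le> X * (3 / 2 * real k)"
    using k_real X_nonneg by (intro mult_left_mono) auto
  moreover have "X * (3 / 2 * real k) = 3 / 2 * (real k * X)" by simp
  ultimately have "l * Y \<le> 8 / 5 * (real k * X)" by linarith
  moreover have "0 \<le> real k * X" using X_nonneg by simp
  moreover have "real k * (X / 4) = real k * X / 4" by simp
  ultimately have "real k * E \<le> real k * (X / 4)" using kE by linarith
  then show ?thesis using k_real by simp
qed

lemma R_row: "r \<in> R \<Longrightarrow> (\<Sum>j\<in>nbrs J r. x j) = l * x r - (\<Sum>j\<in>N r \<inter> Q. x j)"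
proof -
  assume r: "r \<in> R"
  then have rn: "r < n" "r \<notin> K" by (auto simp: R_def)
  have "N r \<inter> R = {}" using R_independent[OF r] by (auto simp: nbrs_def)
  moreover have "G r h" if "h \<in> K" for h by (rule graph_onD(4)[OF graph R_adj[OF that r]])
  then have "N r \<inter> K = K" by (auto simp: nbrs_def)
  ultimately show ?thesis using sum_nbrs_split[of r] eig[OF rn(1)] nbrs_J_outside[OF rn] by simp
qed

text \<open>q misses some h in K, and J adds this edge with weight at least 1 - \<eta>. What q loses
  is at most one neighbour in R and its neighbours in Q.\<close>

lemma Q_row:
  assumes q: "q \<in> Q"
  shows "(\<Sum>j\<in>nbrs J q. x j) \<ge> l * x q + (1 - \<eta> - 4 * real k * \<eta>) - (\<Sum>j\<in>N q \<inter> Q. x j)"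
proof -
  note qn = Q_D[OF q]
  have "\<exists>h\<in>K. \<not> G h q" using q by (auto simp: Q_def R_def)
  then obtain h where h: "h \<in> K" "\<not> G h q" by blast
  then have "h \<notin> N q" using graph_onD(4)[OF graph, of q h] by (auto simp: nbrs_def)
  then have "(\<Sum>j\<in>insert h (N q \<inter> K). x j) = x h + (\<Sum>j\<in>N q \<inter> K. x j)"
    using finite_KRQ by simp
  moreover have "(\<Sum>j\<in>insert h (N q \<inter> K). x j) \<le> (\<Sum>j\<in>K. x j)"
    using h finite_KRQ x_nonneg by (intro sum_mono2) auto
  moreover have "x h \<ge> 1 - \<eta>" by (rule K_x[OF h(1)])
  moreover have "(\<Sum>j\<in>N q \<inter> R. x j) \<le> 4 * real k * \<eta>" using qn by (intro sum_R_nbrs_le) auto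
  ultimately show ?thesis using sum_nbrs_split[of q] eig[of q] qn nbrs_J_outside[of q] by simp
qed

lemma K_row:
  assumes "h \<in> K"
  shows "(\<Sum>j\<in>nbrs J h. x j) \<ge> l * x h"
proof -
  have "(\<Sum>j\<in>N h. x j) \<le> (\<Sum>j\<in>nbrs J h. x j)"
    using nbrs_J_inside[OF assms] finite_nbrs[OF graph_on_join_graph] x_nonneg by (intro sum_mono2) auto
  then show ?thesis using eig[of h] assms K_sub by auto
qed

text \<open>The row comparisons multiplied by x and summed. Q gains almost X; the edges between R
  and Q, counted from both ends, cost at most 8 k \<eta> X, and the edges inside Q at most X /
  4.\<close>

lemma qform_J_lower:
  "qform n J x \<ge> l * (\<Sum>i<n. (x i)\<^sup>2) + (\<Sum>h\<in>K. x h * ((\<Sum>j\<in>nbrs J h. x j) - l * x h)) + X / 2"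
proof -
  define D where "D i = x i * ((\<Sum>j\<in>nbrs J i. x j) - l * x i)" for i
  have "{..<n} = (K \<union> R) \<union> Q" using K_sub by (auto simp: Q_def R_def)
  then have "(\<Sum>i<n. D i) = (\<Sum>i\<in>(K \<union> R) \<union> Q. D i)" by simp
  also have "\<dots> = (\<Sum>i\<in>K \<union> R. D i) + (\<Sum>i\<in>Q. D i)"
    by (rule sum.union_disjoint) (use finite_KRQ in \<open>auto simp: Q_def\<close>)
  also have "(\<Sum>i\<in>K \<union> R. D i) = (\<Sum>i\<in>K. D i) + (\<Sum>i\<in>R. D i)"
    by (rule sum.union_disjoint) (use finite_KRQ in \<open>auto simp: R_def\<close>)
  finally have D: "(\<Sum>i<n. D i) = (\<Sum>i\<in>K. D i) + (\<Sum>i\<in>R. D i) + (\<Sum>i\<in>Q. D i)" .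
  have "qform n J x - l * (\<Sum>i<n. (x i)\<^sup>2) = (\<Sum>i<n. D i)"
    unfolding qform_rows D_def by (simp add: sum_distrib_left sum_subtractf right_diff_distrib power2_eq_square mult_ac)
  moreover have "(\<Sum>i\<in>R. D i) = - (\<Sum>r\<in>R. \<Sum>q\<in>N r \<inter> Q. x r * x q)"
    unfolding D_def sum_negf[symmetric] by (intro sum.cong refl) (simp add: R_row sum_distrib_left sum_negf)
  \<comment> \<open>Summing over q first helps: a vertex of R may have many neighbours in Q, but
    each q has at most one in R.\<close>
  moreover have "(\<Sum>r\<in>R. \<Sum>q\<in>N r \<inter> Q. x r * x q) \<le> 4 * real k * \<eta> * X"
  proof -
    have "(\<Sum>r\<in>R. \<Sum>q\<in>N r \<inter> Q. x r * x q) = (\<Sum>r\<in>R. \<Sum>q\<in>{q\<in>Q. G r q}. x r * x q)"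
      by (intro sum.cong refl) (auto simp: nbrs_def)
    also have "\<dots> = (\<Sum>q\<in>Q. \<Sum>r\<in>{r\<in>R. G r q}. x r * x q)"
      using finite_KRQ by (intro sum.swap_restrict) auto
    also have "\<dots> = (\<Sum>q\<in>Q. x q * (\<Sum>r\<in>N q \<inter> R. x r))"
    proof (rule sum.cong[OF refl])
      fix q
      have "{r\<in>R. G r q} = N q \<inter> R"
        using graph_onD(4)[OF graph, of q] graph_onD(4)[OF graph, of _ q] by (auto simp: nbrs_def)
      then show "(\<Sum>r\<in>{r\<in>R. G r q}. x r * x q) = x q * (\<Sum>r\<in>N q \<inter> R. x r)"
        by (simp add: sum_distrib_left mult.commute)
    qed
    also have "\<dots> \<le> (\<Sum>q\<in>Q. x q * (4 * real k * \<eta>))"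
      using Q_D by (intro sum_mono mult_left_mono sum_R_nbrs_le x_nonneg) auto
    also have "\<dots> = 4 * real k * \<eta> * X" by (simp add: X_def sum_distrib_left mult_ac)
    finally show ?thesis .
  qed
  moreover have "(\<Sum>i\<in>Q. D i) \<ge> (1 - \<eta> - 4 * real k * \<eta>) * X - E"
  proof -
    have "c * X - E = (\<Sum>q\<in>Q. x q * (c - (\<Sum>j\<in>N q \<inter> Q. x j)))" for c
      by (simp add: X_def E_def right_diff_distrib sum_subtractf sum_distrib_left mult.commute)
    then have "(1 - \<eta> - 4 * real k * \<eta>) * X - E
        = (\<Sum>q\<in>Q. x q * ((1 - \<eta> - 4 * real k * \<eta>) - (\<Sum>j\<in>N q \<inter> Q. x j)))" .
    also have "\<dots> \<le> (\<Sum>q\<in>Q. D q)" unfolding D_def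
    proof (intro sum_mono mult_left_mono x_nonneg)
      fix q assume "q \<in> Q"
      from Q_row[OF this] show "(1 - \<eta> - 4 * real k * \<eta>) - (\<Sum>j\<in>N q \<inter> Q. x j) \<le> (\<Sum>j\<in>nbrs J q. x j) - l * x q"
        by linarith
    qed
    finally show ?thesis .
  qed
  moreover have "(1 - \<eta> - 4 * real k * \<eta>) * X - 4 * real k * \<eta> * X \<ge> 3 / 4 * X"
  proof -
    have "3 / 4 \<le> 1 - \<eta> - 4 * real k * \<eta> - 4 * real k * \<eta>"
      using k_eta unfolding mult.assoc by linarith
    then have "3 / 4 * X \<le> (1 - \<eta> - 4 * real k * \<eta> - 4 * real k * \<eta>) * X"
      using X_nonneg by (rule mult_right_mono)
    then show ?thesis by (simp add: left_diff_distrib)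
  qed
  ultimately show ?thesis using D Q_edges_le unfolding D_def by linarith
qed

text \<open>The issue is strictness. The vector x itself is a test vector if X > 0, or if Q is empty
  and some row of K gains an edge; if x vanishes on a nonempty Q, it has to be perturbed.\<close>

lemma spectral_radius_less_join:
  assumes ne: "G \<noteq> J"
  shows "l < graph_spectral_radius n J"
proof -
  have gJ: "graph_on n J" by (rule graph_on_join_graph)
  have Kterm: "x h * ((\<Sum>j\<in>nbrs J h. x j) - l * x h) \<ge> 0" if "h \<in> K" for h
    using K_row[OF that] x_nonneg by simp
  then have Kterms: "(\<Sum>h\<in>K. x h * ((\<Sum>j\<in>nbrs J h. x j) - l * x h)) \<ge> 0" by (intro sum_nonneg)
  have "\<exists>y. qform n J y > l * (\<Sum>i<n. (y i)\<^sup>2)"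
  proof (cases "Q = {}")
    case False
    then obtain q where q: "q \<in> Q" by blast
    then have qn: "q < n" "q \<notin> K" using Q_D by auto
    show ?thesis
    proof (cases "X > 0")
      case True
      then show ?thesis using qform_J_lower Kterms by (intro exI[of _ x]) linarith
    next
      case False
      then have "X = 0" using X_nonneg by simp
      then have xq: "x q = 0" using q finite_KRQ x_nonneg unfolding X_def by (simp add: sum_nonneg_eq_0_iff)
      have "K \<noteq> {}" using K_card k2 by auto
      moreover have "x h > 0" if "h \<in> K" for h using K_x[OF that] k_eta by linarith
      ultimately have "(\<Sum>h\<in>K. x h) > 0" using finite_KRQ by (intro sum_pos) auto
      define s where "s = (\<Sum>h\<in>K. x h)"
      have s: "s > 0" using \<open>(\<Sum>h\<in>K. x h) > 0\<close> by (simp add: s_def)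
      \<comment> \<open>Raising x at q by t gains 2 t s in the form and costs l t^2 in the norm
        term. The choice gives l t \<le> s, and the divisor l + 1 is positive.\<close>
      define t where "t = s / (l + 1)"
      have t: "t > 0" using s l_nonneg by (simp add: t_def)
      let ?y = "x(q := x q + t)"
      have "qform n J ?y = qform n J x + 2 * t * s"
        using qform_upd[OF gJ qn(1), of x t] nbrs_J_outside[OF qn] by (simp add: s_def)
      moreover have "(\<Sum>i<n. (?y i)\<^sup>2) = (\<Sum>i<n. (x i)\<^sup>2) + t\<^sup>2"
      proof -
        have "(\<Sum>i<n. (?y i)\<^sup>2) = t\<^sup>2 + (\<Sum>i\<in>{..<n}-{q}. (x i)\<^sup>2)"
          using qn xq by (subst sum.remove[of _ q]) (auto intro!: sum.cong)
        moreover have "(\<Sum>i<n. (x i)\<^sup>2) = (\<Sum>i\<in>{..<n}-{q}. (x i)\<^sup>2)"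
          using qn xq by (subst sum.remove[of _ q]) auto
        ultimately show ?thesis by simp
      qed
      moreover have "l * t\<^sup>2 < 2 * t * s"
      proof -
        have "l * t \<le> (l + 1) * t" using t by simp
        also have "\<dots> = s" using l_nonneg by (simp add: t_def)
        finally have "l * t < 2 * s" using s by simp
        then have "t * (l * t) < t * (2 * s)" using t by simp
        then show ?thesis by (simp add: power2_eq_square mult_ac)
      qed
      moreover have "qform n J x \<ge> l * (\<Sum>i<n. (x i)\<^sup>2)" using qform_J_lower Kterms X_nonneg by linarith
      ultimately have "qform n J ?y > l * (\<Sum>i<n. (?y i)\<^sup>2)" by (simp add: distrib_left)
      then show ?thesis by blast
    qed
  next
    case True
    \<comment> \<open>Without Q, all edges between K and R are present and R is independent, so G
      can differ from J only inside K.\<close>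
    have "\<exists>h\<in>K. \<exists>h'\<in>K. h \<noteq> h' \<and> \<not> G h h'"
    proof (rule ccontr)
      assume *: "\<not> ?thesis"
      have "G i j = J i j" for i j
      proof
        assume e: "G i j"
        note ij = graph_onD[OF graph e]
        have "i \<in> K \<or> i \<in> R" "j \<in> K \<or> j \<in> R" using ij True by (auto simp: Q_def)
        then have "i \<in> K \<or> j \<in> K" using R_independent[of i j] e by blast
        then show "J i j" using ij by (simp add: join_graph_def)
      next
        assume e: "J i j"
        then have ij: "i < n" "j < n" "i \<noteq> j" "i \<in> K \<or> j \<in> K" by (auto simp: join_graph_def)
        then have iR: "i \<in> K \<or> i \<in> R" "j \<in> K \<or> j \<in> R" using True by (auto simp: Q_def)
        consider "i \<in> K" "j \<in> K" | "i \<in> K" "j \<in> R" | "i \<in> R" "j \<in> K" using iR ij by blast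
        then show "G i j"
        proof cases
          case 1 then show ?thesis using * ij by blast
        next
          case 2 then show ?thesis by (rule R_adj)
        next
          case 3 then show ?thesis by (intro graph_onD(4)[OF graph R_adj[OF 3(2,1)]])
        qed
      qed
      then have "G = J" by (intro ext)
      then show False using ne by contradiction
    qed
    then obtain h h' where h: "h \<in> K" "h' \<in> K" "h \<noteq> h'" "\<not> G h h'" by blast
    have x1: "x h > 0" "x h' > 0" using K_x[OF h(1)] K_x[OF h(2)] k_eta by auto
    have "h' \<notin> N h" using h by (simp add: nbrs_def)
    have "(\<Sum>j\<in>insert h' (N h). x j) \<le> (\<Sum>j\<in>nbrs J h. x j)"
      using nbrs_J_inside[OF h(1)] h K_sub finite_nbrs[OF gJ] x_nonneg
      by (intro sum_mono2) (auto simp: nbrs_def join_graph_def)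
    then have "x h' + l * x h \<le> (\<Sum>j\<in>nbrs J h. x j)"
      using \<open>h' \<notin> N h\<close> finite_nbrs[OF graph] eig[of h] h K_sub by auto
    then have "0 < x h * ((\<Sum>j\<in>nbrs J h. x j) - l * x h)" using x1 by (intro mult_pos_pos) auto
    then have "0 < (\<Sum>h\<in>K. x h * ((\<Sum>j\<in>nbrs J h. x j) - l * x h))"
      using h(1) finite_KRQ Kterm by (intro sum_pos2) auto
    then show ?thesis using qform_J_lower X_nonneg by (intro exI[of _ x]) linarith
  qed
  then obtain y where "l * (\<Sum>i<n. (y i)\<^sup>2) < qform n J y" by blast
  also have "\<dots> \<le> graph_spectral_radius n J * (\<Sum>i<n. (y i)\<^sup>2)" by (rule rayleigh_bound[OF gJ n_pos])
  finally show ?thesis by (rule mult_right_less_imp_less) (intro sum_nonneg, simp)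
qed

end

section \<open>Cycles and isomorphisms\<close>

text \<open>No two vertices outside K are adjacent, so the successor map sends the positions outside
  K injectively to positions in K. At least half of the cycle therefore lies in K.\<close>

lemma join_graph_cycle_free:
  assumes K: "finite K" and m: "m > 2 * card K"
  shows "\<not> contains_subgraph n (join_graph n K) m (cycle_graph m)"
proof
  assume "contains_subgraph n (join_graph n K) m (cycle_graph m)"
  then obtain f where inj: "inj_on f {..<m}"
    and adj: "\<forall>i<m. \<forall>j<m. cycle_graph m i j \<longrightarrow> join_graph n K (f i) (f j)"
    unfolding contains_subgraph_def by blast
  define A where "A = {i. i < m \<and> f i \<notin> K}"
  define B where "B = {i. i < m \<and> f i \<in> K}"
  have fin: "finite A" "finite B" by (auto simp: A_def B_def)
  have cB: "card B \<le> card K"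
  proof (rule card_inj_on_le)
    show "inj_on f B" using inj by (rule inj_on_subset) (auto simp: B_def)
    show "f ` B \<subseteq> K" by (auto simp: B_def)
  qed (rule K)
  have "card A \<le> card B"
  proof (rule card_inj_on_le)
    show "inj_on (\<lambda>i. (i + 1) mod m) A"
      by (rule inj_onI) (auto simp: A_def mod_Suc split: if_splits)
    show "(\<lambda>i. (i + 1) mod m) ` A \<subseteq> B"
    proof
      fix j assume "j \<in> (\<lambda>i. (i + 1) mod m) ` A"
      then obtain i where i: "i < m" "f i \<notin> K" "j = (i + 1) mod m" by (auto simp: A_def)
      then have j: "j < m" by simp
      have "cycle_graph m i j" using i j by (simp add: cycle_graph_def)
      then have "join_graph n K (f i) (f j)" using adj i j by blast
      then show "j \<in> B" using i j by (simp add: join_graph_def B_def)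
    qed
  qed (rule fin)
  moreover have "card (A \<union> B) = card A + card B"
    by (rule card_Un_disjoint) (auto simp: A_def B_def)
  moreover have "A \<union> B = {..<m}" by (auto simp: A_def B_def)
  ultimately show False using cB m by simp
qed

lemma has_cycle_contains:
  assumes g: "graph_on n G" and m: "m \<ge> 2" and c: "has_cycle G m"
  shows "contains_subgraph n G m (cycle_graph m)"
proof -
  obtain p where p: "length p = m" "distinct p" "successively G p" "G (last p) (hd p)"
    using c unfolding has_cycle_def by blast
  have nn: "p \<noteq> []" using p m by auto
  have step: "G (p ! i) (p ! ((i + 1) mod m))" if "i < m" for i
  proof (cases "i + 1 < m")
    case True
    then show ?thesis using successively_nth[OF p(3), of i] p(1) by simp
  next
    case False
    then have "i = m - 1" using that by simp
    then show ?thesis using p(1,4) nn m by (simp add: last_conv_nth hd_conv_nth)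
  qed
  show ?thesis unfolding contains_subgraph_def
  proof (intro exI[of _ "\<lambda>i. p ! i"] conjI allI impI)
    show "inj_on ((!) p) {..<m}" using p(1,2) by (auto simp: inj_on_def nth_eq_iff_index_eq)
    show "(!) p ` {..<m} \<subseteq> {..<n}" using graph_onD(1)[OF g step] by auto
    fix i j assume ij: "i < m" "j < m" "cycle_graph m i j"
    then consider "j = (i + 1) mod m" | "i = (j + 1) mod m" by (auto simp: cycle_graph_def)
    then show "G (p ! i) (p ! j)"
    proof cases
      case 1 then show ?thesis using step[OF ij(1)] by simp
    next
      case 2 then show ?thesis using graph_onD(4)[OF g step[OF ij(2)]] by simp
    qed
  qed
qed

lemma contains_subgraph_iso:
  assumes iso: "graph_iso n G H" and c: "contains_subgraph n G m C"
  shows "contains_subgraph n H m C"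
proof -
  obtain f where f: "bij_betw f {..<n} {..<n}" "\<forall>i<n. \<forall>j<n. G i j \<longleftrightarrow> H (f i) (f j)"
    using iso unfolding graph_iso_def by blast
  obtain g where g: "inj_on g {..<m}" "g ` {..<m} \<subseteq> {..<n}" "\<forall>i<m. \<forall>j<m. C i j \<longrightarrow> G (g i) (g j)"
    using c unfolding contains_subgraph_def by blast
  show ?thesis unfolding contains_subgraph_def
  proof (intro exI[of _ "f \<circ> g"] conjI allI impI)
    show "inj_on (f \<circ> g) {..<m}"
      using g(1) inj_on_subset[OF bij_betw_imp_inj_on[OF f(1)] g(2)] by (rule comp_inj_on)
    show "(f \<circ> g) ` {..<m} \<subseteq> {..<n}" using bij_betw_imp_surj_on[OF f(1)] g(2) by auto
    fix i j assume ij: "i < m" "j < m" "C i j"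
    then have "g i < n" "g j < n" "G (g i) (g j)" using g(2,3) by auto
    then show "H ((f \<circ> g) i) ((f \<circ> g) j)" using f(2) by simp
  qed
qed

lemma graph_iso_sym:
  assumes "graph_iso n G H"
  shows "graph_iso n H G"
proof -
  obtain f where f: "bij_betw f {..<n} {..<n}" "\<forall>i<n. \<forall>j<n. G i j \<longleftrightarrow> H (f i) (f j)"
    using assms unfolding graph_iso_def by blast
  let ?g = "inv_into {..<n} f"
  have "?g i < n" "f (?g i) = i" if "i < n" for i
    using bij_betw_inv_into[OF f(1)] bij_betw_inv_into_right[OF f(1)] that by (auto simp: bij_betw_def)
  then show ?thesis unfolding graph_iso_def
    using bij_betw_inv_into[OF f(1)] f(2) by (intro exI[of _ ?g]) auto
qed

text \<open>The Perron vector of H, transported along the isomorphism, is a test vector for G with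
  the same quotient.\<close>

lemma spectral_radius_le_of_iso:
  assumes G: "graph_on n G" and H: "graph_on n H" and n: "n > 0" and iso: "graph_iso n G H"
  shows "graph_spectral_radius n H \<le> graph_spectral_radius n G"
proof -
  obtain f where f: "bij_betw f {..<n} {..<n}" "\<forall>i<n. \<forall>j<n. G i j \<longleftrightarrow> H (f i) (f j)"
    using iso unfolding graph_iso_def by blast
  obtain x w where x: "\<forall>i. 0 \<le> x i" "\<forall>i<n. x i \<le> (1::real)" "w < n" "x w = 1"
    and eig: "\<forall>i<n. (\<Sum>j\<in>nbrs H i. x j) = graph_spectral_radius n H * x i"
    using perron_vector[OF H n] by (elim exE conjE) (rule that)
  define s where "s = (\<Sum>i<n. (x i)\<^sup>2)"
  have "(x w)\<^sup>2 \<le> s" unfolding s_def by (rule member_le_sum) (use x in auto)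
  then have s: "s > 0" using x(4) by simp
  have fn: "f i < n" if "i < n" for i using bij_betw_apply[OF f(1), of i] that by simp
  have "graph_spectral_radius n H * s = qform n H x"
    unfolding s_def qform_rows sum_distrib_left
    by (rule sum.cong[OF refl]) (use eig in \<open>simp add: power2_eq_square mult_ac flip: sum_distrib_left\<close>)
  also have "\<dots> = (\<Sum>i<n. \<Sum>j<n. of_bool (H i j) * x i * x j)" by (rule qform_conv[OF H])
  also have "\<dots> = (\<Sum>i<n. \<Sum>j<n. of_bool (H (f i) (f j)) * x (f i) * x (f j))"
    unfolding sum.reindex_bij_betw[OF f(1), symmetric, of "\<lambda>j. of_bool (H _ j) * x _ * x j"]
    by (rule sum.reindex_bij_betw[OF f(1), symmetric])
  also have "\<dots> = (\<Sum>i<n. \<Sum>j<n. of_bool (G i j) * x (f i) * x (f j))"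
    using f(2) by (intro sum.cong refl) auto
  also have "\<dots> = qform n G (\<lambda>i. x (f i))" by (rule qform_conv[OF G, symmetric])
  also have "\<dots> \<le> graph_spectral_radius n G * (\<Sum>i<n. (x (f i))\<^sup>2)" by (rule rayleigh_bound[OF G n])
  also have "(\<Sum>i<n. (x (f i))\<^sup>2) = s" unfolding s_def by (rule sum.reindex_bij_betw[OF f(1)])
  finally show ?thesis using s by simp
qed

lemma spectral_radius_iso:
  assumes "graph_on n G" "graph_on n H" "n > 0" "graph_iso n G H"
  shows "graph_spectral_radius n G = graph_spectral_radius n H"
  using spectral_radius_le_of_iso[OF assms]
    spectral_radius_le_of_iso[OF assms(2,1,3) graph_iso_sym[OF assms(4)]] by (rule antisym[rotated])

lemma join_graph_iso_S_graph:
  assumes K: "K \<subseteq> {..<n}" "card K = k"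
  shows "graph_iso n (join_graph n K) (S_graph n k)"
proof -
  have fK: "finite K" using K(1) finite_subset by blast
  have kn: "k \<le> n" using card_mono[OF _ K(1)] K(2) by simp
  obtain f where f: "bij_betw f K {..<k}" using finite_same_card_bij[OF fK, of "{..<k}"] K(2) by auto
  have "card ({..<n} - K) = card {k..<n}" using card_Diff_subset[OF fK K(1)] K(2) by simp
  then obtain g where g: "bij_betw g ({..<n} - K) {k..<n}"
    using finite_same_card_bij[of "{..<n} - K" "{k..<n}"] by auto
  define h where "h i = (if i \<in> K then f i else g i)" for i
  have hK: "bij_betw h K {..<k}" using f by (rule bij_betw_cong[THEN iffD1, rotated]) (simp add: h_def)
  have hg: "bij_betw h ({..<n} - K) {k..<n}" using g by (rule bij_betw_cong[THEN iffD1, rotated]) (simp add: h_def)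
  have "bij_betw h (K \<union> ({..<n} - K)) ({..<k} \<union> {k..<n})"
    by (rule bij_betw_combine[OF hK hg]) auto
  moreover have "K \<union> ({..<n} - K) = {..<n}" "{..<k} \<union> {k..<n} = {..<n}" using K kn by auto
  ultimately have h: "bij_betw h {..<n} {..<n}" by simp
  have hn: "h i < n" if "i < n" for i using bij_betw_apply[OF h, of i] that by simp
  have hk: "h i < k \<longleftrightarrow> i \<in> K" if "i < n" for i
    using bij_betw_apply[OF hK, of i] bij_betw_apply[OF hg, of i] that by (cases "i \<in> K") auto
  have "h i = h j \<longleftrightarrow> i = j" if "i < n" "j < n" for i j
    using bij_betw_imp_inj_on[OF h] that by (auto simp: inj_on_def)
  then show ?thesis unfolding graph_iso_def using h hn hk
    by (intro exI[of _ h]) (simp add: join_graph_def S_graph_def)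
qed

text \<open>The test vector is nearly the Perron vector of the complete bipartite graph between the two
  parts, whose spectral radius is \<open>sqrt (k (n - k))\<close>; for \<open>k \<ge> 2\<close> the clique edges make up for
  the loss.\<close>
lemma spectral_radius_S_graph_ge:
  assumes k: "k \<ge> 2" and n: "real n \<ge> 4 * real k ^ 3"
  shows "sqrt (real k * real n) \<le> graph_spectral_radius n (S_graph n k)"
proof -
  let ?S = "S_graph n k"
  have S: "graph_on n ?S" by (auto simp: graph_on_def S_graph_def)
  have kr: "real k \<ge> 2" using k by simp
  have "real k \<le> real k ^ 3" using kr self_le_power[of "real k" 3] by simp
  then have kn: "real k \<le> real n" "real n > 0" using n kr by linarith+
  then have kn': "k \<le> n" "n > 0" by auto
  define a where "a = sqrt (real n / real k)"
  define s where "s = sqrt (real k * real n)"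
  have ka: "real k * a = s" and a2: "real k * a\<^sup>2 = real n" and s2: "s\<^sup>2 = real k * real n"
    using kr kn by (simp_all add: a_def s_def real_sqrt_divide real_sqrt_mult real_div_sqrt field_simps)
  have s0: "s \<ge> 0" by (simp add: s_def)
  define y where "y i = (if i < k then a else 1)" for i
  have sy: "(\<Sum>i<n. y i) = s + (real n - real k)"
  proof -
    have "(\<Sum>i<n. y i) = (\<Sum>i<k. y i) + (\<Sum>i=k..<n. y i)"
      using sum.atLeastLessThan_concat[of 0 k n y] kn' by (simp add: lessThan_atLeast0)
    also have "(\<Sum>i<k. y i) = s" using ka by (simp add: y_def)
    also have "(\<Sum>i=k..<n. y i) = real n - real k" using kn' by (simp add: y_def of_nat_diff)
    finally show ?thesis .
  qed
  have sy2: "(\<Sum>i<n. (y i)\<^sup>2) = 2 * real n - real k"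
  proof -
    have "(\<Sum>i<n. (y i)\<^sup>2) = (\<Sum>i<k. (y i)\<^sup>2) + (\<Sum>i=k..<n. (y i)\<^sup>2)"
      using sum.atLeastLessThan_concat[of 0 k n "\<lambda>i. (y i)\<^sup>2"] kn' by (simp add: lessThan_atLeast0)
    also have "(\<Sum>i<k. (y i)\<^sup>2) = real n" using a2 by (simp add: y_def)
    also have "(\<Sum>i=k..<n. (y i)\<^sup>2) = real n - real k" using kn' by (simp add: y_def of_nat_diff)
    finally show ?thesis by simp
  qed
  have row1: "(\<Sum>j\<in>nbrs ?S i. y j) = s + (real n - real k) - a" if "i < k" for i
  proof -
    have "nbrs ?S i = {..<n} - {i}" using that kn' by (auto simp: nbrs_def S_graph_def)
    then show ?thesis using sum_diff1[of "{..<n}" y i] sy that kn' by (simp add: y_def)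
  qed
  have row2: "(\<Sum>j\<in>nbrs ?S i. y j) = s" if "k \<le> i" "i < n" for i
  proof -
    have "nbrs ?S i = {..<k}" using that by (auto simp: nbrs_def S_graph_def)
    then show ?thesis using ka by (simp add: y_def)
  qed
  have "qform n ?S y = (\<Sum>i<k. y i * (\<Sum>j\<in>nbrs ?S i. y j)) + (\<Sum>i=k..<n. y i * (\<Sum>j\<in>nbrs ?S i. y j))"
    unfolding qform_rows
    using sum.atLeastLessThan_concat[of 0 k n "\<lambda>i. y i * (\<Sum>j\<in>nbrs ?S i. y j)"] kn' by (simp add: lessThan_atLeast0)
  also have "(\<Sum>i<k. y i * (\<Sum>j\<in>nbrs ?S i. y j)) = (\<Sum>i<k. a * (s + (real n - real k) - a))"
  proof (rule sum.cong[OF refl])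
    fix i assume "i \<in> {..<k}"
    then have "y i = a" "(\<Sum>j\<in>nbrs ?S i. y j) = s + (real n - real k) - a" using row1 by (simp_all add: y_def)
    then show "y i * (\<Sum>j\<in>nbrs ?S i. y j) = a * (s + (real n - real k) - a)" by (simp only:)
  qed
  also have "\<dots> = (real k * a) * (s + (real n - real k)) - real k * a\<^sup>2"
    by (simp add: power2_eq_square algebra_simps)
  also have "\<dots> = s\<^sup>2 + s * (real n - real k) - real n" unfolding ka a2 by (simp add: power2_eq_square algebra_simps)
  also have "(\<Sum>i=k..<n. y i * (\<Sum>j\<in>nbrs ?S i. y j)) = (\<Sum>i=k..<n. s)"
  proof (rule sum.cong[OF refl])
    fix i assume "i \<in> {k..<n}"
    then have "y i = 1" "(\<Sum>j\<in>nbrs ?S i. y j) = s" using row2 by (simp_all add: y_def)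
    then show "y i * (\<Sum>j\<in>nbrs ?S i. y j) = s" by (simp only: mult_1)
  qed
  also have "\<dots> = s * (real n - real k)" using kn' by (simp add: of_nat_diff mult.commute)
  finally have q: "qform n ?S y = (real k - 1) * real n + s * (2 * real n - 2 * real k)"
    unfolding s2 by (simp add: algebra_simps)
  \<comment> \<open>The clique edges contribute (k-1) n, and the deficit to be covered is k s. The
    bound n \<ge> 4 k^3 says exactly that 2 k s \<le> n.\<close>
  have "real k * s \<le> (real k - 1) * real n"
  proof -
    have "4 * real k ^ 3 * real n \<le> real n * real n" using n by (intro mult_right_mono) auto
    moreover have "(2 * (real k * s))\<^sup>2 = 4 * (real k)\<^sup>2 * s\<^sup>2" by (simp add: power_mult_distrib)
    then have "(2 * (real k * s))\<^sup>2 = 4 * real k ^ 3 * real n"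
      unfolding s2 by (simp add: power2_eq_square power3_eq_cube)
    ultimately have "(2 * (real k * s))\<^sup>2 \<le> (real n)\<^sup>2" by (simp add: power2_eq_square)
    then have "2 * (real k * s) \<le> real n" by (rule power2_le_imp_le) simp
    moreover have "1 * real n \<le> (real k - 1) * real n" using kr by (intro mult_right_mono) auto
    moreover have "0 \<le> real k * s" using s0 by simp
    ultimately show ?thesis by linarith
  qed
  then have "s * (2 * real n - real k) \<le> qform n ?S y" unfolding q by (simp add: algebra_simps)
  also have "\<dots> \<le> graph_spectral_radius n ?S * (2 * real n - real k)"
    using rayleigh_bound[OF S kn'(2), of y] unfolding sy2 .
  finally show ?thesis using kn by (simp add: s_def)
qed

section \<open>Existence of extremal graphs and choice of the constants\<close>

text \<open>\<open>graph_on\<close> makes the relation false off {..<n}, so a graph is determined by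
  a subset of a finite square.\<close>

lemma finite_graph_on: "finite {G. graph_on n G}"
proof (rule finite_subset)
  show "{G. graph_on n G} \<subseteq> (\<lambda>E i j. (i, j) \<in> E) ` Pow ({..<n} \<times> {..<n})"
  proof
    fix G assume "G \<in> {G. graph_on n G}"
    then have G: "graph_on n G" by simp
    have "{(i, j). G i j} \<in> Pow ({..<n} \<times> {..<n})"
      using graph_onD(1,2)[OF G] by auto
    moreover have "G = (\<lambda>i j. (i, j) \<in> {(i, j). G i j})" by simp
    ultimately show "G \<in> (\<lambda>E i j. (i, j) \<in> E) ` Pow ({..<n} \<times> {..<n})" by (rule rev_image_eqI)
  qed
qed simp

lemma SPEX_nonempty:
  assumes "graph_on n G" "F_free F n G"
  shows "SPEX n F \<noteq> {}"
proof -
  let ?C = "{G. graph_on n G \<and> F_free F n G}"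
  have "finite ?C" by (rule finite_subset[OF _ finite_graph_on]) auto
  moreover have "?C \<noteq> {}" using assms by blast
  ultimately have "Max (graph_spectral_radius n ` ?C) \<in> graph_spectral_radius n ` ?C"
    by (intro Max_in) auto
  then obtain M where M: "M \<in> ?C" "graph_spectral_radius n M = Max (graph_spectral_radius n ` ?C)" by auto
  have "graph_spectral_radius n G' \<le> graph_spectral_radius n M" if "G' \<in> ?C" for G'
    unfolding M(2) using that \<open>finite ?C\<close> by (intro Max_ge) auto
  then have "M \<in> SPEX n F" using M(1) by (simp add: SPEX_def)
  then show ?thesis by blast
qed

lemma F_free_two_cycles:
  "F_free {(2*k+1, cycle_graph (2*k+1)), (2*k+2, cycle_graph (2*k+2))} n G
    \<longleftrightarrow> \<not> contains_subgraph n G (2*k+1) (cycle_graph (2*k+1))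
      \<and> \<not> contains_subgraph n G (2*k+2) (cycle_graph (2*k+2))"
  by (simp add: F_free_def)

text \<open>G is only required to reach the radius sqrt (k n). Extremality enters afterwards, to
  exclude the second alternative.\<close>

lemma extremal_eq_join:
  assumes k: "k \<ge> 2"
  shows "\<exists>n0. \<forall>n\<ge>n0. \<forall>G. graph_on n G \<longrightarrow> \<not> has_cycle G (2 * k + 1) \<longrightarrow> \<not> has_cycle G (2 * k + 2)
    \<longrightarrow> sqrt (real k * real n) \<le> graph_spectral_radius n G
    \<longrightarrow> (\<exists>K\<subseteq>{..<n}. card K = k
      \<and> (G = join_graph n K \<or> graph_spectral_radius n G < graph_spectral_radius n (join_graph n K)))"
proof -
  have kr: "real k \<ge> 2" using k by simp
  \<comment> \<open>\<delta> is the constant of \<open>max_degree_linear\<close>; \<alpha> and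
    \<epsilon> are such that 7 k \<alpha> and 5 k \<epsilon> are both \<eta> / 8, together the error
    \<eta> / 4 allowed in \<open>extremal_core\<close>.\<close>
  define \<eta> where "\<eta> = 1 / (2000 * real k ^ 3)"
  define \<delta> where "\<delta> = 1 / (2400000 * real k)"
  define \<alpha> where "\<alpha> = \<eta> / (56 * real k)"
  define \<epsilon> where "\<epsilon> = \<eta> / (40 * real k)"
  have k3: "real k ^ 3 \<ge> 1" using kr by (intro one_le_power) auto
  have "\<eta> \<le> 1 / 2000" unfolding \<eta>_def by (rule divide_left_mono) (use k3 k in auto)
  then have eta: "\<eta> > 0" "\<eta> \<le> 1 / 2000" using kr by (simp_all add: \<eta>_def)
  have delta: "\<delta> > 0" "\<delta> \<le> 1" using kr by (auto simp: \<delta>_def field_simps)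
  have al: "\<alpha> > 0" "\<alpha> \<le> \<eta>" using kr eta by (auto simp: \<alpha>_def field_simps)
  have ep: "\<epsilon> > 0" using kr eta by (auto simp: \<epsilon>_def)
  have e4: "5 * real k * \<epsilon> + 7 * real k * \<alpha> = \<eta> / 4" using kr by (simp add: \<alpha>_def \<epsilon>_def field_simps)
  define P where "P n = 7 * real k / (\<alpha> * \<delta> / 72)\<^sup>2 + sqrt (7 * real k * real n) / (\<alpha> * \<delta> / 4)" for n
  \<comment> \<open>One bound P n \<le> c n serves twice: for the smallness hypothesis of
    \<open>few_large_entries\<close> and for the count \<epsilon> n of large entries.\<close>
  define c where "c = min \<epsilon> (\<alpha> * \<delta> / 8)"
  have c: "c > 0" "c \<le> \<epsilon>" "c \<le> \<alpha> * \<delta> / 8" using ep al delta by (simp_all add: c_def)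
  define c1 where "c1 = 7 * real k / (\<alpha> * \<delta> / 72)\<^sup>2"
  define c2 where "c2 = sqrt (7 * real k) / (\<alpha> * \<delta> / 4)"
  have "c2 \<ge> 0" using al delta by (simp add: c2_def)
  from ex_nat_dominating_sqrt[OF c(1) this, of c1] obtain M
    where M: "\<forall>n\<ge>M. c1 + c2 * sqrt (real n) \<le> c * real n" by (elim exE) (rule that)
  have "P n = c1 + c2 * sqrt (real n)" for n
    unfolding P_def c1_def c2_def real_sqrt_mult[of _ "real n"] by simp
  then have PM: "P n \<le> c * real n" if "n \<ge> M" for n
    using M that by simp
  define n0 where "n0 = max (max M 1) (nat \<lceil>200000000 * real k ^ 3\<rceil>)"
  show ?thesis
  proof (intro exI[of _ n0] allI impI)
    fix n G
    assume n: "n0 \<le> n" and g: "graph_on n G" and odd: "\<not> has_cycle G (2 * k + 1)"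
      and even: "\<not> has_cycle G (2 * k + 2)" and l: "sqrt (real k * real n) \<le> graph_spectral_radius n G"
    have nM: "n \<ge> M" and n1: "n > 0" using n by (auto simp: n0_def)
    have big: "real n \<ge> 200000000 * real k ^ 3" using n unfolding n0_def by linarith
    obtain x w where x: "\<forall>i. 0 \<le> x i" "\<forall>i<n. x i \<le> (1::real)" "w < n" "x w = 1"
      and eig: "\<forall>i<n. (\<Sum>j\<in>nbrs G i. x j) = graph_spectral_radius n G * x i"
      and l0: "graph_spectral_radius n G \<ge> 0"
      using perron_vector[OF g n1] by (elim exE conjE) (rule that)
    interpret extremal k n G "graph_spectral_radius n G" x w
    proof
      have "(sqrt (real k * real n))\<^sup>2 \<le> (graph_spectral_radius n G)\<^sup>2" using l by (intro power_mono) auto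
      then show "real k * real n \<le> (graph_spectral_radius n G)\<^sup>2" by simp
    qed (use k n1 g even x eig l0 in auto)
    have dw: "deg w \<ge> \<delta> * real n" using max_degree_linear[OF big] by (simp add: \<delta>_def)
    have "P n \<le> \<alpha> * \<delta> / 8 * real n"
      by (rule order_trans[OF PM[OF nM] mult_right_mono[OF c(3)]]) simp
    moreover have "\<alpha> * \<delta> * real n > 0" using al delta n1 by simp
    ultimately have small: "P n < \<alpha> * \<delta> / 4 * real n" by simp
    have "real (card {z. z < n \<and> x z \<ge> \<alpha>}) \<le> P n"
      using few_large_entries[OF delta dw al(1) _ P_def small] al eta by simp
    then have L: "real (card {z. z < n \<and> x z \<ge> \<alpha>}) \<le> \<epsilon> * real n"
      using order_trans[OF PM[OF nM] mult_right_mono[OF c(2)]] by simp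
    define K where "K = {v. v < n \<and> x v \<ge> 1 - \<eta>}"
    have star: "real k * real n * x v \<le> deg v * (x v + real k - 1) + \<eta> / 4 * real n" if "v < n" for v
      using entry_le_degree[OF that _ L] al e4 by simp
    have Kdeg: "deg h \<ge> (1 - 2 * \<eta>) * real n" if "h \<in> K" for h
    proof -
      have h: "h < n" "x h \<ge> 1 - \<eta>" "x h \<le> 1" using that x_le1 by (auto simp: K_def)
      have "real k * real n * (1 - \<eta>) \<le> real k * real n * x h" using h by (intro mult_left_mono) auto
      also have "\<dots> \<le> deg h * (x h + real k - 1) + \<eta> / 4 * real n" by (rule star[OF h(1)])
      also have "\<dots> \<le> deg h * real k + real k * (\<eta> * real n)"
      proof (intro add_mono mult_left_mono)
        have "1 * (\<eta> * real n) \<le> real k * (\<eta> * real n)" using kr eta by (intro mult_right_mono) auto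
        then show "\<eta> / 4 * real n \<le> real k * (\<eta> * real n)" using mult_nonneg_nonneg[of \<eta> "real n"] eta by simp
      qed (use h in auto)
      finally have "real k * ((1 - 2 * \<eta>) * real n) \<le> real k * deg h" by (simp add: algebra_simps)
      then show ?thesis using kr by simp
    qed
    have "card K \<ge> k" unfolding K_def
      using eta al ep e4 L by (intro card_large_entries_ge[where \<alpha> = \<alpha> and \<epsilon> = \<epsilon>]) auto
    moreover have "card K \<le> k"
    proof (rule card_high_degree_le[OF _ Kdeg])
      show "K \<subseteq> {..<n}" by (auto simp: K_def)
      have "(real k + 1) * (2 * \<eta>) \<le> (real k ^ 3 + real k ^ 3) * (2 * \<eta>)"
        using k3 eta kr self_le_power[of "real k" 3] by (intro mult_right_mono add_mono) auto
      also have "\<dots> \<le> 1 / 2" using k3 by (simp add: \<eta>_def)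
      finally show "(real k + 1) * (2 * \<eta>) \<le> 1 / 2" .
      have "real k \<le> real k ^ 3" using kr self_le_power[of "real k" 3] by simp
      then show "100 * real k \<le> real n" using big k3 by linarith
    qed (use eta in auto)
    ultimately have cK: "card K = k" by simp
    interpret extremal_core k n G "graph_spectral_radius n G" x w K \<eta>
    proof
      show "10000 * real k ^ 3 \<le> real n" using big k3 by linarith
    qed (use odd cK Kdeg star \<eta>_def in \<open>auto simp: K_def\<close>)
    show "\<exists>K\<subseteq>{..<n}. card K = k
      \<and> (G = join_graph n K \<or> graph_spectral_radius n G < graph_spectral_radius n (join_graph n K))"
      using K_sub cK spectral_radius_less_join by (intro exI[of _ K]) auto
  qed
qed

theorem theorem2:
  fixes k :: nat
  assumes "k \<ge> 2"
  shows "\<exists>n0. \<forall>n \<ge> n0. \<forall>G.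
           G \<in> SPEX n {(2*k+1, cycle_graph (2*k+1)), (2*k+2, cycle_graph (2*k+2))}
           \<longleftrightarrow> graph_on n G \<and> graph_iso n G (S_graph n k)"
proof -
  let ?F = "{(2*k+1, cycle_graph (2*k+1)), (2*k+2, cycle_graph (2*k+2))}"
  obtain n1 where n1: "\<forall>n\<ge>n1. \<forall>G. graph_on n G \<longrightarrow> \<not> has_cycle G (2 * k + 1) \<longrightarrow> \<not> has_cycle G (2 * k + 2)
    \<longrightarrow> sqrt (real k * real n) \<le> graph_spectral_radius n G
    \<longrightarrow> (\<exists>K\<subseteq>{..<n}. card K = k
      \<and> (G = join_graph n K \<or> graph_spectral_radius n G < graph_spectral_radius n (join_graph n K)))"
    using extremal_eq_join[OF assms] by (elim exE) (rule that)
  define n0 where "n0 = max (max n1 1) (4 * k ^ 3)"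
  have join_free: "F_free ?F n (join_graph n K)" if "finite K" "card K = k" for n K
    unfolding F_free_two_cycles using that by (simp add: join_graph_cycle_free)
  have S: "graph_on n (S_graph n k)" "F_free ?F n (S_graph n k)" for n
    unfolding S_graph_eq_join by (rule graph_on_join_graph, rule join_free) auto
  have iso: "graph_iso n G (S_graph n k)" if n: "n \<ge> n0" and G: "G \<in> SPEX n ?F" for n G
  proof -
    have "4 * k ^ 3 \<le> n" using n by (simp add: n0_def)
    then have "real (4 * k ^ 3) \<le> real n" by (rule of_nat_mono)
    then have "sqrt (real k * real n) \<le> graph_spectral_radius n (S_graph n k)"
      using assms by (intro spectral_radius_S_graph_ge) auto
    also have "\<dots> \<le> graph_spectral_radius n G" using G S unfolding SPEX_def by blast
    finally have l: "sqrt (real k * real n) \<le> graph_spectral_radius n G" .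
    have g: "graph_on n G" "F_free ?F n G" using G unfolding SPEX_def by auto
    have "\<not> has_cycle G (2 * k + 1)" "\<not> has_cycle G (2 * k + 2)"
      using g(2) has_cycle_contains[OF g(1), of "2 * k + 1"] has_cycle_contains[OF g(1), of "2 * k + 2"] assms
      unfolding F_free_two_cycles by auto
    from n1[rule_format, OF _ g(1) this l] n obtain K where K: "K \<subseteq> {..<n}" "card K = k"
      "G = join_graph n K \<or> graph_spectral_radius n G < graph_spectral_radius n (join_graph n K)"
      by (auto simp: n0_def)
    have "finite K" using K(1) finite_subset by blast
    \<comment> \<open>The join on K is itself admissible, so a strictly larger radius would
      contradict the maximality of G.\<close>
    then have "graph_spectral_radius n (join_graph n K) \<le> graph_spectral_radius n G"
      using G join_free[of K n] K(2) graph_on_join_graph unfolding SPEX_def by blast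
    then have "G = join_graph n K" using K(3) by simp
    then show ?thesis using join_graph_iso_S_graph[OF K(1,2)] by simp
  qed
  show ?thesis
  proof (intro exI[of _ n0] allI impI iffI)
    fix n G assume n: "n0 \<le> n" and G: "G \<in> SPEX n ?F"
    then show "graph_on n G \<and> graph_iso n G (S_graph n k)" using iso by (simp add: SPEX_def)
  next
    fix n G assume n: "n0 \<le> n" and G: "graph_on n G \<and> graph_iso n G (S_graph n k)"
    have npos: "n > 0" using n by (simp add: n0_def)
    \<comment> \<open>For the converse, some extremal M exists and is isomorphic to S_{n,k} by the
      first direction. So S_{n,k}, and with it G, attains the maximal radius.\<close>
    have "SPEX n ?F \<noteq> {}" by (rule SPEX_nonempty[OF S])
    then obtain M where M: "M \<in> SPEX n ?F" by blast
    then have gM: "graph_on n M" by (simp add: SPEX_def)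
    have "graph_spectral_radius n M = graph_spectral_radius n (S_graph n k)"
      by (rule spectral_radius_iso[OF gM S(1) npos iso[OF n M]])
    also have "\<dots> = graph_spectral_radius n G"
      using spectral_radius_iso[OF _ S(1) npos, of G] G by simp
    finally have "graph_spectral_radius n M = graph_spectral_radius n G" .
    moreover have "F_free ?F n G"
      using S(2)[of n] contains_subgraph_iso[OF conjunct2[OF G]] unfolding F_free_two_cycles by blast
    ultimately show "G \<in> SPEX n ?F" using M G by (simp add: SPEX_def)
  qed
qed

end
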